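(* Let $\Omega \subset \mathbb{R}^n$ be an open, bounded, connected domain with $C^2$ boundary. Let $p \in (1,2]$, let $f \in C^1(\overline{\Omega})$ be semiconcave in $\Omega$, and let $H(x,\beta) = |\beta|^p - f(x)$. Assume (1) $f(x) = \min_{y\in \overline{\Omega}}f(y)$ for all $x \in \partial \Omega$; (2) $f(x) > \min_{y\in \overline{\Omega}}f(y)$ for all $x \in \Omega$; (3) there exists a constant $C>0$ such that $|Df(x)| \leq C \left(f(x)-\min_{y\in \overline{\Omega}}f(y)\right)^{1/p}$ for all $x \in \Omega$. Let $u$ be the constrained viscosity solution of $$u+H(x,Du)\le 0 \ \text{ in } \Omega,\qquad u+H(x,Du)\ge 0\ \text{ on } \overline{\Omega}.$$ Fix $x \in \Omega$ and let $\xi$ be a minimizing curve for $u(x)$. Then $T_{x, \xi}=+\infty$; that is, no minimizing curve can escape the domain $\Omega$ in finite time.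
   Context: Semiconcavity: a function $g$ is semiconcave in an open set $\Omega$ if there is a constant $K\ge 0$ with $g(x+h)+g(x-h)-2g(x)\le K|h|^2$ for all $x,h\in\mathbb{R}^n$ such that $\{x+sh:-1\le s\le 1\}\subset\Omega$. Constrained viscosity solution: $u\in C(\overline{\Omega})$ is the constrained viscosity solution of $u+H(x,Du)\le 0$ in $\Omega$, $u+H(x,Du)\ge 0$ on $\overline{\Omega}$ if (i) whenever $\phi$ is $C^1$ and $u-\phi$ has a local maximum at $x_0\in\Omega$, then $u(x_0)+H(x_0,D\phi(x_0))\le 0$; and (ii) whenever $\phi\in C^1(\overline{\Omega})$ and $u-\phi$ has a local minimum relative to $\overline{\Omega}$ at $x_0\in\overline{\Omega}$ (boundary points allowed), then $u(x_0)+H(x_0,D\phi(x_0))\ge 0$. Under the present hypotheses it exists, is unique, and is given by $$u(x)=\inf\left\{\int_0^\infty e^{-s}\left(C_p|\dot\gamma(s)|^q+f(\gamma(s))\right)ds:\ \gamma\in \mathrm{AC}([0,\infty);\overline{\Omega}),\ \gamma(0)=x\right\},$$ where $\frac1p+\frac1q=1$, $C_p=q^{-1}p^{-q/p}$, and $\mathrm{AC}([0,\infty);\overline{\Omega})$ is the set of absolutely continuous curves $\gamma:[0,\infty)\to\overline{\Omega}$. Minimizing curve: $\xi\in\mathrm{AC}([0,\infty);\overline{\Omega})$ is a minimizing curve for $u(x)$ if $\xi(0)=x$ and $\xi$ attains this infimum. Its first hitting time of the boundary is $T_{x,\xi}:=\inf\{s\in[0,+\infty):\xi(s)\in\partial\Omega\}$,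 with $\inf\emptyset=+\infty$. *)

theory Defs
  imports "HOL-Analysis.Analysis"
begin

subsection \<open>Regularity\<close>

definition C1_on :: "'a::euclidean_space set \<Rightarrow> ('a \<Rightarrow> real) \<Rightarrow> ('a \<Rightarrow> 'a) \<Rightarrow> bool" where
  "C1_on S f Df \<longleftrightarrow> (\<forall>x\<in>S. GDERIV f x :> Df x) \<and> continuous_on S Df"

text \<open>The class $C^1(\overline{\Omega})$: the function is $C^1$ in $\Omega$, and the function and its
  gradient extend continuously to $\overline{\Omega}$. On the boundary, \<open>Df\<close> is that extension;
  it is determined by its values in $\Omega$.\<close>

definition C1_on_closure :: "'a::euclidean_space set \<Rightarrow> ('a \<Rightarrow> real) \<Rightarrow> ('a \<Rightarrow> 'a) \<Rightarrow> bool" where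
  "C1_on_closure \<Omega> f Df \<longleftrightarrow>
     C1_on \<Omega> f Df \<and> continuous_on (closure \<Omega>) f \<and> continuous_on (closure \<Omega>) Df"

definition C2 :: "('a::euclidean_space \<Rightarrow> real) \<Rightarrow> bool" where
  "C2 g \<longleftrightarrow> (\<exists>Dg (D2g :: 'a \<Rightarrow> 'a \<Rightarrow>\<^sub>L 'a).
     (\<forall>x. GDERIV g x :> Dg x) \<and>
     (\<forall>x. (Dg has_derivative blinfun_apply (D2g x)) (at x)) \<and>
     continuous_on UNIV D2g)"

text \<open>Near each boundary point, $\Omega$ is the region strictly above a $C^2$ graph in some direction
  \<open>\<nu>\<close>. The height \<open>g\<close> is a function of the \<open>n - 1\<close> coordinates orthogonal to \<open>\<nu>\<close>; it is
  represented by a $C^2$ function on the whole space that is evaluated only at projections onto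
  the hyperplane orthogonal to \<open>\<nu>\<close>.\<close>

definition C2_boundary :: "'a::euclidean_space set \<Rightarrow> bool" where
  "C2_boundary \<Omega> \<longleftrightarrow> (\<forall>z\<in>frontier \<Omega>. \<exists>r>0. \<exists>\<nu> g. norm \<nu> = 1 \<and> C2 g \<and>
     \<Omega> \<inter> ball z r = {x \<in> ball z r. x \<bullet> \<nu> > g (x - (x \<bullet> \<nu>) *\<^sub>R \<nu>)})"

definition semiconcave_on :: "'a::euclidean_space set \<Rightarrow> ('a \<Rightarrow> real) \<Rightarrow> bool" where
  "semiconcave_on \<Omega> g \<longleftrightarrow> (\<exists>K\<ge>0. \<forall>x h. (\<forall>s\<in>{-1..1}. x + s *\<^sub>R h \<in> \<Omega>) \<longrightarrow>
     g (x + h) + g (x - h) - 2 * g x \<le> K * (norm h)\<^sup>2)"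

subsection \<open>Constrained viscosity solutions\<close>

definition hamiltonian :: "real \<Rightarrow> ('a::euclidean_space \<Rightarrow> real) \<Rightarrow> 'a \<Rightarrow> 'a \<Rightarrow> real" where
  "hamiltonian p f x \<beta> = norm \<beta> powr p - f x"

definition local_max_within :: "'a::topological_space set \<Rightarrow> ('a \<Rightarrow> real) \<Rightarrow> 'a \<Rightarrow> bool" where
  "local_max_within S w x\<^sub>0 \<longleftrightarrow> x\<^sub>0 \<in> S \<and> (\<forall>\<^sub>F y in at x\<^sub>0 within S. w y \<le> w x\<^sub>0)"

definition local_min_within :: "'a::topological_space set \<Rightarrow> ('a \<Rightarrow> real) \<Rightarrow> 'a \<Rightarrow> bool" where
  "local_min_within S w x\<^sub>0 \<longleftrightarrow> x\<^sub>0 \<in> S \<and> (\<forall>\<^sub>F y in at x\<^sub>0 within S. w x\<^sub>0 \<le> w y)"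

definition constrained_viscosity_solution ::
    "'a::euclidean_space set \<Rightarrow> ('a \<Rightarrow> 'a \<Rightarrow> real) \<Rightarrow> ('a \<Rightarrow> real) \<Rightarrow> bool" where
  "constrained_viscosity_solution \<Omega> H u \<longleftrightarrow>
     continuous_on (closure \<Omega>) u \<and>
     (\<forall>\<phi> D\<phi>. C1_on \<Omega> \<phi> D\<phi> \<longrightarrow>
        (\<forall>x\<^sub>0. local_max_within \<Omega> (\<lambda>y. u y - \<phi> y) x\<^sub>0 \<longrightarrow> u x\<^sub>0 + H x\<^sub>0 (D\<phi> x\<^sub>0) \<le> 0)) \<and>
     (\<forall>\<phi> D\<phi>. C1_on_closure \<Omega> \<phi> D\<phi> \<longrightarrow>
        (\<forall>x\<^sub>0. local_min_within (closure \<Omega>) (\<lambda>y. u y - \<phi> y) x\<^sub>0 \<longrightarrow> u x\<^sub>0 + H x\<^sub>0 (D\<phi> x\<^sub>0) \<ge> 0))"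

subsection \<open>Minimizing curves\<close>

definition abs_cont_on :: "real \<Rightarrow> real \<Rightarrow> (real \<Rightarrow> 'a::metric_space) \<Rightarrow> bool" where
  "abs_cont_on a b \<gamma> \<longleftrightarrow> (\<forall>\<epsilon>>0. \<exists>\<delta>>0. \<forall>(n::nat) s t.
     (\<forall>i<n. a \<le> s i \<and> s i \<le> t i \<and> t i \<le> b) \<and>
     disjoint_family_on (\<lambda>i. {s i<..<t i}) {..<n} \<and>
     (\<Sum>i<n. t i - s i) < \<delta>
     \<longrightarrow> (\<Sum>i<n. dist (\<gamma> (s i)) (\<gamma> (t i))) < \<epsilon>)"

text \<open>As usual on an unbounded interval, absolute continuity on $[0,\infty)$ means absolute continuity
  on every compact subinterval. Values at negative times are irrelevant.\<close>

definition AC_curves :: "'a::metric_space set \<Rightarrow> (real \<Rightarrow> 'a) set" where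
  "AC_curves S = {\<gamma>. (\<forall>T\<ge>0. abs_cont_on 0 T \<gamma>) \<and> (\<forall>t\<ge>0. \<gamma> t \<in> S)}"

definition running_cost ::
    "real \<Rightarrow> real \<Rightarrow> ('a::euclidean_space \<Rightarrow> real) \<Rightarrow> (real \<Rightarrow> 'a) \<Rightarrow> real \<Rightarrow> real" where
  "running_cost p q f \<gamma> s =
     exp (- s) * ((1 / q) * p powr (- (q / p)) * norm (vector_derivative \<gamma> (at s)) powr q + f (\<gamma> s))"

text \<open>The cost is an extended real: the integral of the positive part may be $+\infty$, while that of the
  negative part is finite when \<open>f\<close> is bounded below along the curve. Since \<open>ennreal\<close> truncates
  negative numbers to 0, the two integrands are the positive and the negative part.
  The derivative of the curve exists only almost everywhere, hence the completed measure.\<close>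

definition cost ::
    "real \<Rightarrow> real \<Rightarrow> ('a::euclidean_space \<Rightarrow> real) \<Rightarrow> (real \<Rightarrow> 'a) \<Rightarrow> ereal" where
  "cost p q f \<gamma> =
     enn2ereal (\<integral>\<^sup>+ s\<in>{0..}. ennreal (running_cost p q f \<gamma> s) \<partial>lebesgue) -
     enn2ereal (\<integral>\<^sup>+ s\<in>{0..}. ennreal (- running_cost p q f \<gamma> s) \<partial>lebesgue)"

definition minimizing_curve ::
    "'a::euclidean_space set \<Rightarrow> real \<Rightarrow> real \<Rightarrow> ('a \<Rightarrow> real) \<Rightarrow> 'a \<Rightarrow> (real \<Rightarrow> 'a) \<Rightarrow> bool" where
  "minimizing_curve \<Omega> p q f x \<xi> \<longleftrightarrow>
     \<xi> \<in> AC_curves (closure \<Omega>) \<and> \<xi> 0 = x \<and>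
     cost p q f \<xi> = (INF \<gamma>\<in>{\<gamma> \<in> AC_curves (closure \<Omega>). \<gamma> 0 = x}. cost p q f \<gamma>)"

definition hitting_time :: "'a::euclidean_space set \<Rightarrow> (real \<Rightarrow> 'a) \<Rightarrow> ereal" where
  "hitting_time \<Omega> \<xi> = Inf {ereal s | s. 0 \<le> s \<and> \<xi> s \<in> frontier \<Omega>}"

end

theory Submission
  imports Defs
begin

text \<open>Write $\varphi(t) = f(\xi(t)) - \min f$. Comparing \<open>\<xi>\<close> with the curve that stops at time \<open>a\<close>
  bounds the remaining discounted cost, and hence $\int_a^{a+\delta} |\dot\xi|^q$, by a multiple of
  $\varphi(a)$. By Young's inequality the length of \<open>\<xi>\<close> on $[a, a+\delta]$ is then at most a small
  multiple of $\varphi(a)^{1/q}$. If \<open>\<xi>\<close> first met the boundary at time \<open>T\<close>, take for \<open>a\<close> the maximum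
  point of $\varphi$ on $[T-\delta, T]$: on $[a, T)$ hypothesis (3) gives
  $|Df(\xi)| \le C \varphi(a)^{1/p}$, so $\varphi$ drops by at most half of
  $\varphi(a)^{1/p} \varphi(a)^{1/q} = \varphi(a)$, contradicting $\varphi(T) = 0$.

  The length is controlled by $\int |\dot\xi|$ because an absolutely continuous curve is differentiable
  almost everywhere and is the integral of its derivative.\<close>

subsection \<open>Differentiability of functions of bounded variation\<close>

text \<open>The scaling in \<open>M = \<phi> a\<close> decides the argument. The window length
  \<open>\<delta>\<close> must be fixed before the maximum point is known, hence independently of
  \<open>M\<close>. A Young threshold proportional to \<open>M powr (1 / q)\<close> makes both parts
  of the length bound scale with that power, and hypothesis (3) supplies
  \<open>M powr (1 / p)\<close>, so the drop of \<open>\<phi>\<close> is linear in \<open>M\<close>.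
  With a smaller exponent in (3) a negative power of \<open>M\<close> would remain. The maximum
  point reconciles two needs: the cost bound involves \<open>\<phi>\<close> at the starting time
  only, whereas (3) involves it at all later times of the window. The role of length is played by a
  function \<open>W\<close> whose increments dominate distances along the curve; it is the primitive
  of the Young bound on the speed. Subtracting the minimum of \<open>f\<close> makes the integrand
  nonnegative, so that passing to subintervals and dropping terms preserves upper bounds. Almost
  everywhere differentiability rests on Vitali coverings by chords: steep chords of a monotone
  function cannot cover much length.\<close>

lemma mono_on_sum_disjoint_intervals_le:
  fixes P :: "real \<Rightarrow> real"
  assumes "finite D" "mono_on {a..b} P" "a \<le> b"
    and "\<And>s t. (s, t) \<in> D \<Longrightarrow> a \<le> s \<and> s < t \<and> t \<le> b"
    and "pairwise (\<lambda>(s, t) (s', t'). disjnt {s..t} {s'..t'}) D"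
  shows "(\<Sum>(s, t)\<in>D. P t - P s) \<le> P b - P a"
  using assms
proof (induction D arbitrary: b rule: finite_ranking_induct[where f = snd])
  case empty
  then show ?case by (auto dest: mono_onD)
next
  case (insert z D)
  obtain s t where z: "z = (s, t)" by (cases z)
  have st: "a \<le> s" "s < t" "t \<le> b" using insert.prems(3)[of s t] z by auto
  \<comment> \<open>The split-off interval has the largest right endpoint, so one disjoint from it
    must end before \<open>s\<close>. The induction hypothesis is then needed on
    \<open>{a..s}\<close>, which is why \<open>b\<close> is arbitrary.\<close>
  have left: "a \<le> s' \<and> s' < t' \<and> t' \<le> s" if "(s', t') \<in> D" "(s', t') \<noteq> z" for s' t'
  proof -
    have "disjnt {s'..t'} {s..t}"
      using insert.prems(4) that z by (auto simp: pairwise_def)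
    moreover have "t' \<le> t" using insert.hyps(2)[OF that(1)] z by simp
    moreover have "a \<le> s'" "s' < t'" using insert.prems(3)[of s' t'] that by auto
    ultimately show ?thesis
      by (metis atLeastAtMost_iff disjnt_iff linorder_le_less_linear nless_le)
  qed
  show ?case
  proof (cases "z \<in> D")
    case True
    then show ?thesis using insert.IH[of b] insert.prems by (simp add: insert_absorb)
  next
    case False
    have "(\<Sum>(s, t)\<in>D. P t - P s) \<le> P s - P a"
    proof (rule insert.IH)
      show "mono_on {a..s} P" using insert.prems(1) st by (auto intro: mono_on_subset)
      show "pairwise (\<lambda>(s, t) (s', t'). disjnt {s..t} {s'..t'}) D"
        using insert.prems(4) by (rule pairwise_subset) auto
      show "a \<le> s' \<and> s' < t' \<and> t' \<le> s" if "(s', t') \<in> D" for s' t'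
        using left[OF that] that False by blast
    qed (use st in auto)
    moreover have "P t \<le> P b" by (rule mono_onD[OF insert.prems(1)]) (use st in auto)
    ultimately show ?thesis using insert.hyps(1) False z by simp
  qed
qed

text \<open>Vitali: chords of \<open>P\<close> with slope at least \<open>K\<close> shrink to every
  point of \<open>E\<close>, so countably many disjoint ones cover \<open>E\<close> up to a null
  set, and their total length is at most the total increment over \<open>K\<close>. The slope bound
  is asked only of chords inside \<open>{a..b}\<close>, where \<open>P\<close> is monotone; callers
  need not shrink \<open>d\<close> themselves.\<close>

lemma outer_measure_le_mono_on_increment:
  fixes P :: "real \<Rightarrow> real"
  assumes mono: "mono_on {a..b} P" and "a \<le> b" and "0 < K" and "E \<subseteq> {a<..<b}"
    and ex: "\<And>x d. x \<in> E \<Longrightarrow> 0 < d \<Longrightarrow>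
      \<exists>s t. s < t \<and> x - d < s \<and> s \<le> x \<and> x \<le> t \<and> t < x + d \<and> (a \<le> s \<longrightarrow> t \<le> b \<longrightarrow> K * (t - s) \<le> P t - P s)"
  obtains T where "E \<subseteq> T" "T \<in> lmeasurable" "measure lebesgue T \<le> (P b - P a) / K"
proof -
  define I where "I = {(s, t). a \<le> s \<and> s < t \<and> t \<le> b \<and> K * (t - s) \<le> P t - P s}"
  define c where "c = (\<lambda>(s, t). (s + t) / 2 :: real)"
  define r where "r = (\<lambda>(s, t). (t - s) / 2 :: real)"
  have cb: "cball (c i) (r i) = {fst i..snd i}" for i
    by (auto simp: c_def r_def cball_eq_atLeastAtMost split_beta field_simps)
  obtain C where C: "countable C" "C \<subseteq> I"
      "pairwise (\<lambda>i j. disjnt (cball (c i) (r i)) (cball (c j) (r j))) C"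
      "negligible (E - (\<Union>i \<in> C. cball (c i) (r i)))"
  proof (rule Vitali_covering_theorem_cballs[of I r E c])
    show "0 < r i" if "i \<in> I" for i using that by (auto simp: I_def r_def)
    show "\<exists>i. i \<in> I \<and> x \<in> cball (c i) (r i) \<and> r i < d" if "x \<in> E" "0 < d" for x d
    proof -
      \<comment> \<open>Shrinking to \<open>d'\<close> keeps the chord inside \<open>{a..b}\<close>
        and so discharges the two guards in \<open>ex\<close>.\<close>
      define d' where "d' = min d (min (x - a) (b - x))"
      have "a < x" "x < b" using that assms(4) by auto
      then have "0 < d'" using that by (auto simp: d'_def)
      from ex[OF that(1) this] obtain s t where st: "s < t" "x - d' < s" "s \<le> x" "x \<le> t" "t < x + d'"
        "a \<le> s \<longrightarrow> t \<le> b \<longrightarrow> K * (t - s) \<le> P t - P s" by blast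
      then have "a \<le> s" "t \<le> b" "s > x - d" "t < x + d" by (auto simp: d'_def)
      with st show ?thesis
        by (intro exI[of _ "(s, t)"]) (auto simp: I_def cb, auto simp: r_def)
    qed
  qed
  define U where "U = (\<Union>i\<in>C. {fst i..snd i})"
  have disj: "pairwise (\<lambda>i j. disjnt {fst i..snd i} {fst j..snd j}) C" using C(3) cb by simp
  \<comment> \<open>A bound uniform over finite subfamilies passes to the countable union
    \<open>U\<close>.\<close>
  have fin: "measure lebesgue (\<Union>i\<in>D. {fst i..snd i}) \<le> (P b - P a) / K" if "D \<subseteq> C" "finite D" for D
  proof -
    have "measure lebesgue (\<Union>i\<in>D. {fst i..snd i}) \<le> (\<Sum>i\<in>D. measure lebesgue {fst i..snd i})"
      by (rule measure_UNION_le) (use that in auto)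
    also have "\<dots> \<le> (\<Sum>(s, t)\<in>D. (P t - P s) / K)"
    proof (rule sum_mono)
      fix i assume "i \<in> D"
      then have "i \<in> I" using that C by blast
      then show "measure lebesgue {fst i..snd i} \<le> (case i of (s, t) \<Rightarrow> (P t - P s) / K)"
        using \<open>0 < K\<close> by (auto simp: I_def field_simps split_beta)
    qed
    also have "\<dots> = (\<Sum>(s, t)\<in>D. P t - P s) / K"
      by (simp add: sum_divide_distrib split_beta)
    also have "\<dots> \<le> (P b - P a) / K"
    proof (rule divide_right_mono)
      show "(\<Sum>(s, t)\<in>D. P t - P s) \<le> P b - P a"
      proof (rule mono_on_sum_disjoint_intervals_le)
        show "pairwise (\<lambda>(s, t) (s', t'). disjnt {s..t} {s'..t'}) D"
          using pairwise_subset[OF disj that(1)] by (simp add: case_prod_unfold)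
        show "a \<le> s \<and> s < t \<and> t \<le> b" if "(s, t) \<in> D" for s t
          using that \<open>D \<subseteq> C\<close> C(2) by (auto simp: I_def)
      qed (use that assms in auto)
    qed (use assms in auto)
    finally show ?thesis .
  qed
  have cU: "countable ((\<lambda>i. {fst i..snd i}) ` C)" using C by simp
  have U: "U \<in> lmeasurable" "measure lebesgue U \<le> (P b - P a) / K"
  proof -
    have *: "measure lebesgue (\<Union>F) \<le> (P b - P a) / K" if "F \<subseteq> (\<lambda>i. {fst i..snd i}) ` C" "finite F" for F
    proof -
      obtain D where "D \<subseteq> C" "finite D" "F = (\<lambda>i. {fst i..snd i}) ` D"
        using finite_subset_image[OF \<open>finite F\<close> \<open>F \<subseteq> _\<close>] by blast
      then show ?thesis using fin[of D] by simp
    qed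
    have **: "D \<in> lmeasurable" if "D \<in> (\<lambda>i. {fst i..snd i}) ` C" for D using that by auto
    show "U \<in> lmeasurable" "measure lebesgue U \<le> (P b - P a) / K"
      unfolding U_def
      by (rule fmeasurable_Union_bound[OF cU ** *] measure_Union_bound[OF cU ** *]; assumption)+
  qed
  have N: "negligible (E - U)" using C(4) cb by (simp add: U_def)
  show ?thesis
  \<comment> \<open>\<open>E\<close> need not be measurable; adding the null set
    \<open>E - U\<close> to \<open>U\<close> gives a measurable superset without raising the
    measure.\<close>
  proof (rule that[of "U \<union> (E - U)"])
    show "U \<union> (E - U) \<in> lmeasurable"
      using U N negligible_imp_measurable by blast
    have "measure lebesgue (U \<union> (E - U)) \<le> measure lebesgue U + measure lebesgue (E - U)"
      by (rule measure_Un_le) (use U N negligible_imp_measurable in \<open>auto intro: fmeasurableD\<close>)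
    then show "measure lebesgue (U \<union> (E - U)) \<le> (P b - P a) / K"
      using U(2) N negligible_imp_measure0 by fastforce
  qed auto
qed

section \<open>Partitions and total variation\<close>

definition partition_of :: "real \<Rightarrow> real \<Rightarrow> nat \<Rightarrow> (nat \<Rightarrow> real) \<Rightarrow> bool" where
  "partition_of a b n x \<longleftrightarrow> x 0 = a \<and> x n = b \<and> (\<forall>i<n. x i \<le> x (Suc i))"

definition variation_sum :: "(real \<Rightarrow> 'a::metric_space) \<Rightarrow> nat \<Rightarrow> (nat \<Rightarrow> real) \<Rightarrow> real" where
  "variation_sum F n x = (\<Sum>i<n. dist (F (x i)) (F (x (Suc i))))"

definition bounded_variation_on :: "real \<Rightarrow> real \<Rightarrow> (real \<Rightarrow> 'a::metric_space) \<Rightarrow> bool" where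
  "bounded_variation_on a b F \<longleftrightarrow> (\<exists>B. \<forall>n x. partition_of a b n x \<longrightarrow> variation_sum F n x \<le> B)"

lemma partition_of_mono:
  assumes "partition_of a b n x" "i \<le> j" "j \<le> n"
  shows "x i \<le> x j"
proof -
  have "x i \<le> x (i + k)" if "i + k \<le> n" for k
    using that
  proof (induction k)
    case (Suc k)
    then have "x (i + k) \<le> x (Suc (i + k))" using assms(1) by (simp add: partition_of_def)
    then show ?case using Suc by simp
  qed simp
  from this[of "j - i"] show ?thesis using assms by simp
qed

lemma partition_of_bounds:
  assumes "partition_of a b n x" "i \<le> n"
  shows "a \<le> x i" "x i \<le> b"
  using partition_of_mono[OF assms(1), of 0 i] partition_of_mono[OF assms(1), of i n] assms
  by (auto simp: partition_of_def)

lemma partition_of_append: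
  assumes "partition_of a b n x" "b \<le> c"
  shows "partition_of a c (Suc n) (x(Suc n := c))"
    and "variation_sum F (Suc n) (x(Suc n := c)) = variation_sum F n x + dist (F b) (F c)"
  using assms by (auto simp: partition_of_def variation_sum_def less_Suc_eq intro!: sum.cong)

text \<open>The least index with \<open>y \<le> x j\<close> passes over repeated points, which
  \<open>partition_of\<close> allows.\<close>

lemma partition_of_cell:
  assumes "partition_of a b n x" "y \<in> {a<..b}"
  obtains i where "i < n" "x i < y" "y \<le> x (Suc i)"
proof -
  define j where "j = (LEAST j. y \<le> x j)"
  have xn: "y \<le> x n" using assms by (auto simp: partition_of_def)
  have j: "y \<le> x j" unfolding j_def by (rule LeastI[of "\<lambda>j. y \<le> x j", OF xn])
  have "j \<le> n" unfolding j_def by (rule Least_le[of "\<lambda>j. y \<le> x j", OF xn])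
  have "j \<noteq> 0"
  proof
    assume "j = 0"
    then show False using j assms by (simp add: partition_of_def)
  qed
  then obtain i where i: "j = Suc i" by (cases j) auto
  have "\<not> y \<le> x i" using not_less_Least[of i "\<lambda>j. y \<le> x j"] i j_def by auto
  with that[of i] i j \<open>j \<le> n\<close> show ?thesis by auto
qed

text \<open>\<open>V t\<close> is the total variation on \<open>{a..t}\<close>. Appending
  \<open>t\<close> to a partition of \<open>{a..s}\<close> raises the sum by the distance, whence
  the first property; the second is near-attainment of the supremum at \<open>b\<close>.\<close>

lemma bounded_variation_on_majorant:
  fixes G :: "real \<Rightarrow> 'a::metric_space"
  assumes "bounded_variation_on a b G" "a \<le> b"
  obtains V :: "real \<Rightarrow> real" where
    "\<And>s t. a \<le> s \<Longrightarrow> s \<le> t \<Longrightarrow> t \<le> b \<Longrightarrow> dist (G s) (G t) \<le> V t - V s"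
    "\<And>\<eta>. 0 < \<eta> \<Longrightarrow> \<exists>n x. partition_of a b n x \<and> V b - V a \<le> variation_sum G n x + \<eta>"
proof -
  define S where "S t = {variation_sum G n x | n x. partition_of a t n x}" for t
  define V where "V t = Sup (S t)" for t
  obtain B where B: "\<And>n x. partition_of a b n x \<Longrightarrow> variation_sum G n x \<le> B"
    using assms by (auto simp: bounded_variation_on_def)
  have bdd: "bdd_above (S t)" if "t \<le> b" for t
  proof (rule bdd_aboveI)
    fix v assume "v \<in> S t"
    then obtain n x where v: "v = variation_sum G n x" "partition_of a t n x" by (auto simp: S_def)
    from B[OF partition_of_append(1)[OF v(2) that]] partition_of_append(2)[OF v(2) that, of G]
    show "v \<le> B" using v zero_le_dist[of "G t" "G b"] by linarith
  qed
  have part: "partition_of a t 1 (\<lambda>i. if i = 0 then a else t)" if "a \<le> t" for t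
    using that by (simp add: partition_of_def)
  then have ne: "S t \<noteq> {}" if "a \<le> t" for t using that by (force simp: S_def)
  show ?thesis
  proof (rule that[of V])
    fix s t assume st: "a \<le> s" "s \<le> t" "t \<le> b"
    have "V s \<le> V t - dist (G s) (G t)"
      unfolding V_def[of s]
    proof (rule cSup_least[OF ne[OF st(1)]])
      fix v assume "v \<in> S s"
      then obtain n x where v: "v = variation_sum G n x" "partition_of a s n x" by (auto simp: S_def)
      have "variation_sum G (Suc n) (x(Suc n := t)) \<in> S t"
        using partition_of_append(1)[OF v(2) st(2)] by (auto simp: S_def)
      from cSup_upper[OF this bdd[OF st(3)]] partition_of_append(2)[OF v(2) st(2), of G] v
      show "v \<le> V t - dist (G s) (G t)" by (simp add: V_def)
    qed
    then show "dist (G s) (G t) \<le> V t - V s" by simp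
  next
    fix \<eta> :: real assume "0 < \<eta>"
    \<comment> \<open>The sign of \<open>V a\<close> suffices: since it is nonnegative,
      \<open>V b - V a\<close> is at most \<open>V b\<close>.\<close>
    have "partition_of a a 0 (\<lambda>i. a)" by (simp add: partition_of_def)
    then have "variation_sum G 0 (\<lambda>i. a) \<in> S a" by (auto simp: S_def)
    from cSup_upper[OF this bdd[OF assms(2)]] have "0 \<le> V a" by (simp add: V_def variation_sum_def)
    have "V b - \<eta> < V b" using \<open>0 < \<eta>\<close> by simp
    then obtain v where "v \<in> S b" "V b - \<eta> < v"
      unfolding V_def[of b] using less_cSup_iff[OF ne[OF assms(2)] bdd] by auto
    then show "\<exists>n x. partition_of a b n x \<and> V b - V a \<le> variation_sum G n x + \<eta>"
      using \<open>0 \<le> V a\<close> by (fastforce simp: S_def)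
  qed
qed

text \<open>On a cell of a nearly optimal partition the variation exceeds the increment of \<open>G\<close> by little,
  so chords whose slope has the sign opposite to that increment cover little of the cell.\<close>

lemma negligible_opposite_slopes:
  fixes G :: "real \<Rightarrow> real"
  assumes bv: "bounded_variation_on a b G" and "a \<le> b" and \<epsilon>: "0 < \<epsilon>" and E: "E \<subseteq> {a<..<b}"
    and inc: "\<And>x d. x \<in> E \<Longrightarrow> 0 < d \<Longrightarrow>
      \<exists>s t. s < t \<and> x - d < s \<and> s \<le> x \<and> x \<le> t \<and> t < x + d \<and> \<epsilon> * (t - s) \<le> G t - G s"
    and dec: "\<And>x d. x \<in> E \<Longrightarrow> 0 < d \<Longrightarrow>
      \<exists>s t. s < t \<and> x - d < s \<and> s \<le> x \<and> x \<le> t \<and> t < x + d \<and> \<epsilon> * (t - s) \<le> G s - G t"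
  shows "negligible E"
proof -
  obtain V :: "real \<Rightarrow> real" where
    V: "\<And>s t. a \<le> s \<Longrightarrow> s \<le> t \<Longrightarrow> t \<le> b \<Longrightarrow> dist (G s) (G t) \<le> V t - V s" and
    Vp: "\<And>\<eta>. 0 < \<eta> \<Longrightarrow> \<exists>n x. partition_of a b n x \<and> V b - V a \<le> variation_sum G n x + \<eta>"
    using bounded_variation_on_majorant[OF bv \<open>a \<le> b\<close>] by blast
  show ?thesis
    unfolding negligible_outer
  proof (intro allI impI)
    fix e :: real assume "0 < e"
    \<comment> \<open>Dividing the excess \<open>\<eta>\<close> by the slope
      \<open>\<epsilon>\<close> leaves \<open>e / 2\<close>, strictly below
      \<open>e\<close>.\<close>
    define \<eta> where "\<eta> = \<epsilon> * e / 2"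
    have "0 < \<eta>" using \<open>0 < e\<close> \<epsilon> by (simp add: \<eta>_def)
    then obtain n x where x: "partition_of a b n x" and Vx: "V b - V a \<le> variation_sum G n x + \<eta>"
      using Vp by blast
    have cell: "\<exists>T. E \<inter> {x i<..<x (Suc i)} \<subseteq> T \<and> T \<in> lmeasurable \<and>
        measure lebesgue T \<le> (V (x (Suc i)) - V (x i) - dist (G (x i)) (G (x (Suc i)))) / \<epsilon>" if "i < n" for i
    proof -
      have i: "a \<le> x i" "x (Suc i) \<le> b" "x i \<le> x (Suc i)"
        using partition_of_bounds[OF x] x that by (auto simp: partition_of_def)
      \<comment> \<open>\<open>\<sigma>\<close> is the sign of the increment of \<open>G\<close>
        over the cell. Since \<open>V\<close> dominates increments of \<open>G\<close>,
        \<open>P\<close> is monotone, and its own increment over the cell is exactly the excess of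
        variation.\<close>
      define \<sigma> :: real where "\<sigma> = (if G (x i) \<le> G (x (Suc i)) then 1 else - 1)"
      define P where "P t = V t - \<sigma> * G t" for t
      have "mono_on {x i..x (Suc i)} P"
      proof (rule mono_onI)
        fix s t assume "s \<in> {x i..x (Suc i)}" "t \<in> {x i..x (Suc i)}" "s \<le> t"
        then show "P s \<le> P t" using V[of s t] i by (auto simp: P_def \<sigma>_def dist_real_def)
      qed
      then obtain T where "E \<inter> {x i<..<x (Suc i)} \<subseteq> T" "T \<in> lmeasurable"
        "measure lebesgue T \<le> (P (x (Suc i)) - P (x i)) / \<epsilon>"
      proof (rule outer_measure_le_mono_on_increment[OF _ i(3) \<epsilon>, of P "E \<inter> {x i<..<x (Suc i)}"])
        fix y d assume y: "y \<in> E \<inter> {x i<..<x (Suc i)}" "0 < (d::real)"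
        \<comment> \<open>Along a chord running against \<open>\<sigma>\<close>, the term with
          \<open>G\<close> raises \<open>P\<close> by at least \<open>\<epsilon> * (t - s)\<close>,
          and \<open>V\<close> can only add to this.\<close>
        have "\<exists>s t. s < t \<and> y - d < s \<and> s \<le> y \<and> y \<le> t \<and> t < y + d \<and> \<epsilon> * (t - s) \<le> - \<sigma> * (G t - G s)"
        proof (cases "G (x i) \<le> G (x (Suc i))")
          case True
          then show ?thesis using dec[of y d] y by (simp add: \<sigma>_def)
        next
          case False
          then show ?thesis using inc[of y d] y by (simp add: \<sigma>_def)
        qed
        then obtain s t where "s < t" "y - d < s" "s \<le> y" "y \<le> t" "t < y + d" "\<epsilon> * (t - s) \<le> - \<sigma> * (G t - G s)"
          by blast
        moreover have "V s \<le> V t" if "x i \<le> s" "t \<le> x (Suc i)"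
          using V[of s t] i that \<open>s < t\<close> zero_le_dist[of "G s" "G t"] by linarith
        ultimately show "\<exists>s t. s < t \<and> y - d < s \<and> s \<le> y \<and> y \<le> t \<and> t < y + d \<and>
            (x i \<le> s \<longrightarrow> t \<le> x (Suc i) \<longrightarrow> \<epsilon> * (t - s) \<le> P t - P s)"
          by (intro exI[of _ s] exI[of _ t]) (auto simp: P_def algebra_simps)
      qed auto
      moreover have "P (x (Suc i)) - P (x i) = V (x (Suc i)) - V (x i) - dist (G (x i)) (G (x (Suc i)))"
        by (auto simp: P_def \<sigma>_def dist_real_def)
      ultimately show ?thesis by auto
    qed
    then obtain T where T: "\<And>i. i < n \<Longrightarrow> E \<inter> {x i<..<x (Suc i)} \<subseteq> T i"
      "\<And>i. i < n \<Longrightarrow> T i \<in> lmeasurable"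
      "\<And>i. i < n \<Longrightarrow> measure lebesgue (T i) \<le> (V (x (Suc i)) - V (x i) - dist (G (x i)) (G (x (Suc i)))) / \<epsilon>"
      by metis
    define U where "U = (\<Union>i<n. T i)"
    have U: "U \<in> lmeasurable" unfolding U_def by (rule fmeasurable.finite_UN) (use T in auto)
    have N: "negligible (x ` {..n})" by (rule negligible_finite) simp
    have Nm: "x ` {..n} \<in> lmeasurable" using N negligible_imp_measurable by blast
    have "measure lebesgue U \<le> (\<Sum>i<n. measure lebesgue (T i))"
      unfolding U_def by (rule measure_UNION_le) (use T in \<open>auto intro: fmeasurableD\<close>)
    also have "\<dots> \<le> (\<Sum>i<n. (V (x (Suc i)) - V (x i) - dist (G (x i)) (G (x (Suc i)))) / \<epsilon>)"
      by (rule sum_mono) (use T in auto)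
    also have "\<dots> = ((\<Sum>i<n. V (x (Suc i)) - V (x i)) - variation_sum G n x) / \<epsilon>"
      by (simp add: sum_divide_distrib sum_subtractf variation_sum_def diff_divide_distrib)
    also have "(\<Sum>i<n. V (x (Suc i)) - V (x i)) = V b - V a"
      using x by (subst sum_lessThan_telescope) (simp add: partition_of_def)
    also have "(V b - V a - variation_sum G n x) / \<epsilon> \<le> \<eta> / \<epsilon>"
      by (rule divide_right_mono) (use Vx \<epsilon> in auto)
    also have "\<dots> < e" using \<epsilon> \<open>0 < e\<close> by (simp add: \<eta>_def)
    finally have mU: "measure lebesgue U < e" .
    \<comment> \<open>The cells were taken open, so the finitely many partition points are added
      back.\<close>
    show "\<exists>T. E \<subseteq> T \<and> T \<in> lmeasurable \<and> measure lebesgue T < e"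
    proof (intro exI conjI)
      show "U \<union> x ` {..n} \<in> lmeasurable" using U Nm by blast
      have "measure lebesgue (U \<union> x ` {..n}) \<le> measure lebesgue U + measure lebesgue (x ` {..n})"
        by (rule measure_Un_le) (use U Nm in \<open>auto intro: fmeasurableD\<close>)
      then show "measure lebesgue (U \<union> x ` {..n}) < e"
        using mU N negligible_imp_measure0 by fastforce
      show "E \<subseteq> U \<union> x ` {..n}"
      proof
        fix y assume y: "y \<in> E"
        then have "y \<in> {a<..b}" using E by auto
        then obtain i where i: "i < n" "x i < y" "y \<le> x (Suc i)" using partition_of_cell[OF x] by blast
        show "y \<in> U \<union> x ` {..n}"
        proof (cases "y = x (Suc i)")
          case False
          then have "y \<in> T i" using i y T(1)[of i] by auto
          then show ?thesis using i by (auto simp: U_def)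
        qed (use i in auto)
      qed
    qed
  qed
qed

text \<open>Chords of the variation function \<open>V\<close> are at least as steep as those of
  \<open>F\<close>, so \<open>E\<close> has outer measure at most \<open>(V b - V a) / K\<close> for
  every positive \<open>K\<close>.\<close>

lemma negligible_infinite_slopes:
  fixes F :: "real \<Rightarrow> 'a::metric_space"
  assumes bv: "bounded_variation_on a b F" and "a \<le> b" and E: "E \<subseteq> {a<..<b}"
    and ex: "\<And>x d N. x \<in> E \<Longrightarrow> 0 < d \<Longrightarrow>
      \<exists>s t. s < t \<and> x - d < s \<and> s \<le> x \<and> x \<le> t \<and> t < x + d \<and> N * (t - s) \<le> dist (F s) (F t)"
  shows "negligible E"
proof -
  obtain V :: "real \<Rightarrow> real" where
    V: "\<And>s t. a \<le> s \<Longrightarrow> s \<le> t \<Longrightarrow> t \<le> b \<Longrightarrow> dist (F s) (F t) \<le> V t - V s" and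
    "\<And>\<eta>. 0 < \<eta> \<Longrightarrow> \<exists>n x. partition_of a b n x \<and> V b - V a \<le> variation_sum F n x + \<eta>"
    using bounded_variation_on_majorant[OF bv \<open>a \<le> b\<close>] by blast
  have mono: "mono_on {a..b} V"
  proof (rule mono_onI)
    fix s t assume "s \<in> {a..b}" "t \<in> {a..b}" "s \<le> t"
    then show "V s \<le> V t" using order_trans[OF zero_le_dist V[of s t]] by auto
  qed
  show ?thesis
    unfolding negligible_outer
  proof (intro allI impI)
    fix e :: real assume "0 < e"
    have Vab: "V a \<le> V b" using order_trans[OF zero_le_dist V[of a b]] \<open>a \<le> b\<close> by auto
    \<comment> \<open>The added 1 keeps \<open>K\<close> positive when \<open>V a = V b\<close> and
      makes the final bound strict.\<close>
    define K where "K = (V b - V a + 1) / e"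
    have K: "0 < K" using Vab \<open>0 < e\<close> by (simp add: K_def)
    obtain T where "E \<subseteq> T" "T \<in> lmeasurable" "measure lebesgue T \<le> (V b - V a) / K"
    proof (rule outer_measure_le_mono_on_increment[OF mono \<open>a \<le> b\<close> K E])
      fix x d assume "x \<in> E" "0 < (d::real)"
      then obtain s t where st: "s < t" "x - d < s" "s \<le> x" "x \<le> t" "t < x + d" "K * (t - s) \<le> dist (F s) (F t)"
        using ex by blast
      then have "K * (t - s) \<le> V t - V s" if "a \<le> s" "t \<le> b" using V[of s t] that by auto
      with st show "\<exists>s t. s < t \<and> x - d < s \<and> s \<le> x \<and> x \<le> t \<and> t < x + d \<and>
          (a \<le> s \<longrightarrow> t \<le> b \<longrightarrow> K * (t - s) \<le> V t - V s)" by blast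
    qed
    moreover have "(V b - V a) / K < e"
      using Vab \<open>0 < e\<close> by (simp add: K_def field_simps)
    ultimately show "\<exists>T. E \<subseteq> T \<and> T \<in> lmeasurable \<and> measure lebesgue T < e" by auto
  qed
qed

text \<open>Tilting by the line of slope \<open>(r + r') / 2\<close> moves thresholds
  \<open>r < r'\<close> to \<open>- (r' - r) / 2\<close> and \<open>(r' - r) / 2\<close>, the
  symmetric form that \<open>negligible_opposite_slopes\<close> takes.\<close>

lemma bounded_variation_on_diff_linear:
  fixes F :: "real \<Rightarrow> real"
  assumes "bounded_variation_on a b F"
  shows "bounded_variation_on a b (\<lambda>x. F x - c * x)"
proof -
  obtain B where B: "\<And>n x. partition_of a b n x \<Longrightarrow> variation_sum F n x \<le> B"
    using assms by (auto simp: bounded_variation_on_def)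
  have "variation_sum (\<lambda>x. F x - c * x) n x \<le> B + \<bar>c\<bar> * (b - a)" if x: "partition_of a b n x" for n x
  proof -
    have "variation_sum (\<lambda>x. F x - c * x) n x \<le> (\<Sum>i<n. dist (F (x i)) (F (x (Suc i))) + \<bar>c\<bar> * (x (Suc i) - x i))"
      unfolding variation_sum_def
    proof (rule sum_mono)
      fix i assume "i \<in> {..<n}"
      then have "x i \<le> x (Suc i)" using x by (simp add: partition_of_def)
      moreover have "dist (F (x i) - c * x i) (F (x (Suc i)) - c * x (Suc i))
          = \<bar>(F (x i) - F (x (Suc i))) + c * (x (Suc i) - x i)\<bar>"
        by (simp add: dist_real_def algebra_simps)
      moreover have "\<dots> \<le> \<bar>F (x i) - F (x (Suc i))\<bar> + \<bar>c * (x (Suc i) - x i)\<bar>" by (rule abs_triangle_ineq)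
      ultimately show "dist (F (x i) - c * x i) (F (x (Suc i)) - c * x (Suc i))
          \<le> dist (F (x i)) (F (x (Suc i))) + \<bar>c\<bar> * (x (Suc i) - x i)"
        by (simp add: abs_mult dist_real_def)
    qed
    also have "\<dots> = variation_sum F n x + \<bar>c\<bar> * (\<Sum>i<n. x (Suc i) - x i)"
      by (simp add: sum.distrib variation_sum_def sum_distrib_left)
    also have "(\<Sum>i<n. x (Suc i) - x i) = b - a"
      using x by (subst sum_lessThan_telescope) (simp add: partition_of_def)
    finally show ?thesis using B[OF x] by simp
  qed
  then show ?thesis unfolding bounded_variation_on_def by blast
qed

text \<open>Where \<open>F\<close> is not differentiable, either chord slopes are unbounded or the
  lower and upper limits of the difference quotient differ. Such a gap contains two rationals, so
  the countably many null sets \<open>E r r'\<close> suffice.\<close>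

lemma bounded_variation_on_differentiable_ae:
  fixes F :: "real \<Rightarrow> real"
  assumes bv: "bounded_variation_on a b F" and "a \<le> b"
  shows "negligible {x \<in> {a<..<b}. \<not> F differentiable (at x)}"
proof -
  define near where "near x d s t \<longleftrightarrow> s < t \<and> x - d < s \<and> s \<le> x \<and> x \<le> t \<and> t < x + d" for x d s t :: real
  define Einf where "Einf = {x \<in> {a<..<b}. \<forall>d>0. \<forall>N. \<exists>s t. near x d s t \<and> N * (t - s) \<le> dist (F s) (F t)}"
  define E where "E r r' = {x \<in> {a<..<b}. (\<forall>d>0. \<exists>s t. near x d s t \<and> F t - F s \<le> r * (t - s)) \<and>
    (\<forall>d>0. \<exists>s t. near x d s t \<and> r' * (t - s) \<le> F t - F s)}" for r r'
  have "negligible Einf"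
    by (rule negligible_infinite_slopes[OF bv \<open>a \<le> b\<close>]) (auto simp: Einf_def near_def)
  moreover have "negligible (E r r')" if "r < r'" for r r'
  proof (rule negligible_opposite_slopes[OF bounded_variation_on_diff_linear[OF bv, of "(r + r') / 2"] \<open>a \<le> b\<close>])
    show "0 < (r' - r) / 2" using that by simp
    show "E r r' \<subseteq> {a<..<b}" by (auto simp: E_def)
    fix x d :: real assume x: "x \<in> E r r'" "0 < d"
    obtain s t where "near x d s t" "r' * (t - s) \<le> F t - F s" using x by (auto simp: E_def)
    then show "\<exists>s t. s < t \<and> x - d < s \<and> s \<le> x \<and> x \<le> t \<and> t < x + d \<and>
      (r' - r) / 2 * (t - s) \<le> F t - (r + r') / 2 * t - (F s - (r + r') / 2 * s)"
      by (intro exI[of _ s] exI[of _ t]) (auto simp: near_def field_simps)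
    obtain s t where "near x d s t" "F t - F s \<le> r * (t - s)" using x by (auto simp: E_def)
    then show "\<exists>s t. s < t \<and> x - d < s \<and> s \<le> x \<and> x \<le> t \<and> t < x + d \<and>
      (r' - r) / 2 * (t - s) \<le> F s - (r + r') / 2 * s - (F t - (r + r') / 2 * t)"
      by (intro exI[of _ s] exI[of _ t]) (auto simp: near_def field_simps)
  qed
  moreover have "countable {(r, r'). r \<in> \<rat> \<and> r' \<in> \<rat> \<and> r < (r' :: real)}"
    by (rule countable_subset[of _ "\<rat> \<times> \<rat>"]) (auto intro: countable_rat)
  ultimately have N: "negligible (Einf \<union> (\<Union>(r, r')\<in>{(r, r'). r \<in> \<rat> \<and> r' \<in> \<rat> \<and> r < r'}. E r r'))"
    by (intro negligible_Un negligible_countable_Union) auto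
  have "x \<in> Einf \<union> (\<Union>(r, r')\<in>{(r, r'). r \<in> \<rat> \<and> r' \<in> \<rat> \<and> r < r'}. E r r')"
    if x: "x \<in> {a<..<b}" and nd: "\<not> F differentiable (at x)" for x
  proof (rule ccontr)
    assume good: "\<not> ?thesis"
    define \<phi> where "\<phi> y = (F y - F x) / (y - x)" for y
    \<comment> \<open>A difference quotient at \<open>x\<close> is the slope of a chord with
      \<open>x\<close> as one end; \<open>min\<close> and \<open>max\<close> treat both sides at
      once.\<close>
    have chord: "near x d (min x y) (max x y) \<and> F (max x y) - F (min x y) = \<phi> y * (max x y - min x y)"
      if "y \<noteq> x" "dist y x < d" for y d
      using that by (auto simp: near_def \<phi>_def min_def max_def dist_real_def field_simps)
    from good x obtain d N where dN: "0 < d" "\<And>s t. near x d s t \<Longrightarrow> dist (F s) (F t) < N * (t - s)"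
      by (auto simp: Einf_def not_le)
    have bdd: "\<bar>\<phi> y\<bar> \<le> N" if "y \<noteq> x" "dist y x < d" for y
    proof -
      have "\<bar>\<phi> y\<bar> * (max x y - min x y) < N * (max x y - min x y)"
        using dN(2)[of "min x y" "max x y"] chord[OF that] by (auto simp: dist_real_def abs_mult abs_minus_commute)
      moreover have "0 < max x y - min x y" using that by auto
      ultimately show ?thesis by simp
    qed
    \<comment> \<open>The limits are taken in \<open>ereal\<close>, where they always exist;
      \<open>bdd\<close> makes them finite, as a derivative must be.\<close>
    have lower: "- N \<le> Liminf (at x) (\<lambda>y. ereal (\<phi> y))"
    proof -
      have "\<forall>\<^sub>F y in at x. ereal (- N) \<le> ereal (\<phi> y)"
        unfolding eventually_at using dN(1) bdd by (force simp: abs_le_iff)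
      then show ?thesis by (rule Liminf_bounded)
    qed
    have upper: "Limsup (at x) (\<lambda>y. ereal (\<phi> y)) \<le> N"
    proof -
      have "\<forall>\<^sub>F y in at x. ereal (\<phi> y) \<le> ereal N"
        unfolding eventually_at using dN(1) bdd by (force simp: abs_le_iff)
      then show ?thesis by (rule Limsup_bounded)
    qed
    have le: "Liminf (at x) (\<lambda>y. ereal (\<phi> y)) \<le> Limsup (at x) (\<lambda>y. ereal (\<phi> y))"
      by (rule Liminf_le_Limsup) simp
    have eq: "Liminf (at x) (\<lambda>y. ereal (\<phi> y)) = Limsup (at x) (\<lambda>y. ereal (\<phi> y))"
    proof (rule ccontr)
      assume "\<not> ?thesis"
      with le have "Liminf (at x) (\<lambda>y. ereal (\<phi> y)) < Limsup (at x) (\<lambda>y. ereal (\<phi> y))" by simp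
      then obtain r' where r': "Liminf (at x) (\<lambda>y. ereal (\<phi> y)) < real_of_rat r'"
        "real_of_rat r' < Limsup (at x) (\<lambda>y. ereal (\<phi> y))" using ereal_dense3 by blast
      then obtain r where r: "Liminf (at x) (\<lambda>y. ereal (\<phi> y)) < real_of_rat r"
        "ereal (real_of_rat r) < real_of_rat r'" using ereal_dense3 by blast
      have f1: "\<exists>y. y \<noteq> x \<and> dist y x < d \<and> \<phi> y < real_of_rat r" if "0 < d" for d
      proof (rule ccontr)
        assume "\<not> ?thesis"
        then have "\<forall>\<^sub>F y in at x. ereal (real_of_rat r) \<le> ereal (\<phi> y)"
          unfolding eventually_at using that by (force simp: not_less)
        from Liminf_bounded[OF this] show False using r(1) by simp
      qed
      have f2: "\<exists>y. y \<noteq> x \<and> dist y x < d \<and> real_of_rat r' < \<phi> y" if "0 < d" for d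
      proof (rule ccontr)
        assume "\<not> ?thesis"
        then have "\<forall>\<^sub>F y in at x. ereal (\<phi> y) \<le> ereal (real_of_rat r')"
          unfolding eventually_at using that by (force simp: not_less)
        from Limsup_bounded[OF this] show False using r'(2) by simp
      qed
      have "x \<in> E (real_of_rat r) (real_of_rat r')"
        unfolding E_def
      proof (intro CollectI conjI allI impI x)
        fix d :: real assume "0 < d"
        obtain y where y: "y \<noteq> x" "dist y x < d" "\<phi> y < real_of_rat r" using f1[OF \<open>0 < d\<close>] by blast
        have "\<phi> y * (max x y - min x y) \<le> real_of_rat r * (max x y - min x y)"
          by (rule mult_right_mono) (use y in auto)
        then show "\<exists>s t. near x d s t \<and> F t - F s \<le> real_of_rat r * (t - s)"
          using chord[OF y(1,2)] by (intro exI[of _ "min x y"] exI[of _ "max x y"]) auto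
        obtain y where y: "y \<noteq> x" "dist y x < d" "real_of_rat r' < \<phi> y" using f2[OF \<open>0 < d\<close>] by blast
        have "real_of_rat r' * (max x y - min x y) \<le> \<phi> y * (max x y - min x y)"
          by (rule mult_right_mono) (use y in auto)
        then show "\<exists>s t. near x d s t \<and> real_of_rat r' * (t - s) \<le> F t - F s"
          using chord[OF y(1,2)] by (intro exI[of _ "min x y"] exI[of _ "max x y"]) auto
      qed
      moreover have "real_of_rat r < real_of_rat r'" using r by simp
      ultimately show False using good by auto
    qed
    obtain L where L: "Limsup (at x) (\<lambda>y. ereal (\<phi> y)) = ereal L"
      using lower upper eq by (cases "Limsup (at x) (\<lambda>y. ereal (\<phi> y))") auto
    have "((\<lambda>y. ereal (\<phi> y)) \<longlongrightarrow> ereal L) (at x)"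
      using eq L by (subst tendsto_iff_Liminf_eq_Limsup) auto
    then have "(\<phi> \<longlongrightarrow> L) (at x)" by simp
    then have "(F has_real_derivative L) (at x)"
      by (simp add: has_field_derivative_iff \<phi>_def[abs_def])
    then show False using nd real_differentiable_def by blast
  qed
  then have "{x \<in> {a<..<b}. \<not> F differentiable (at x)}
      \<subseteq> Einf \<union> (\<Union>(r, r')\<in>{(r, r'). r \<in> \<rat> \<and> r' \<in> \<rat> \<and> r < r'}. E r r')" by blast
  with N show ?thesis by (rule negligible_subset)
qed

subsection \<open>Absolutely continuous curves\<close>

lemma abs_cont_on_subinterval:
  assumes "abs_cont_on a b \<gamma>" "a \<le> c" "d \<le> b"
  shows "abs_cont_on c d \<gamma>"
  unfolding abs_cont_on_def
proof (intro allI impI)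
  fix \<epsilon> :: real assume "0 < \<epsilon>"
  obtain \<delta> where "0 < \<delta>" and
    \<delta>: "\<forall>(n::nat) s t. (\<forall>i<n. a \<le> s i \<and> s i \<le> t i \<and> t i \<le> b) \<and>
      disjoint_family_on (\<lambda>i. {s i<..<t i}) {..<n} \<and> (\<Sum>i<n. t i - s i) < \<delta>
      \<longrightarrow> (\<Sum>i<n. dist (\<gamma> (s i)) (\<gamma> (t i))) < \<epsilon>"
    using assms(1)[unfolded abs_cont_on_def, THEN spec, THEN mp, OF \<open>0 < \<epsilon>\<close>] by (elim exE conjE) (rule that)
  show "\<exists>\<delta>>0. \<forall>(n::nat) s t. (\<forall>i<n. c \<le> s i \<and> s i \<le> t i \<and> t i \<le> d) \<and>
     disjoint_family_on (\<lambda>i. {s i<..<t i}) {..<n} \<and> (\<Sum>i<n. t i - s i) < \<delta>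
     \<longrightarrow> (\<Sum>i<n. dist (\<gamma> (s i)) (\<gamma> (t i))) < \<epsilon>"
  proof (intro exI[of _ \<delta>] conjI allI impI \<open>0 < \<delta>\<close>)
    fix n :: nat and s t :: "nat \<Rightarrow> real"
    assume st: "(\<forall>i<n. c \<le> s i \<and> s i \<le> t i \<and> t i \<le> d) \<and>
      disjoint_family_on (\<lambda>i. {s i<..<t i}) {..<n} \<and> (\<Sum>i<n. t i - s i) < \<delta>"
    have "a \<le> s i \<and> s i \<le> t i \<and> t i \<le> b" if "i < n" for i
      using st that assms(2,3) by force
    then show "(\<Sum>i<n. dist (\<gamma> (s i)) (\<gamma> (t i))) < \<epsilon>"
      by (intro \<delta>[rule_format]) (use st in auto)
  qed
qed

lemma abs_cont_on_dist_le:
  assumes "abs_cont_on a b \<gamma>"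
    and le: "\<And>s t. a \<le> s \<Longrightarrow> s \<le> t \<Longrightarrow> t \<le> b \<Longrightarrow> dist (F s) (F t) \<le> dist (\<gamma> s) (\<gamma> t)"
  shows "abs_cont_on a b F"
  unfolding abs_cont_on_def
proof (intro allI impI)
  fix \<epsilon> :: real assume "0 < \<epsilon>"
  obtain \<delta> where "0 < \<delta>" and
    \<delta>: "\<forall>(n::nat) s t. (\<forall>i<n. a \<le> s i \<and> s i \<le> t i \<and> t i \<le> b) \<and>
      disjoint_family_on (\<lambda>i. {s i<..<t i}) {..<n} \<and> (\<Sum>i<n. t i - s i) < \<delta>
      \<longrightarrow> (\<Sum>i<n. dist (\<gamma> (s i)) (\<gamma> (t i))) < \<epsilon>"
    using assms(1)[unfolded abs_cont_on_def, THEN spec, THEN mp, OF \<open>0 < \<epsilon>\<close>] by (elim exE conjE) (rule that)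
  have "(\<Sum>i<n. dist (F (s i)) (F (t i))) < \<epsilon>"
    if "\<forall>i<n::nat. a \<le> s i \<and> s i \<le> t i \<and> t i \<le> b" "disjoint_family_on (\<lambda>i. {s i<..<t i}) {..<n}"
      "(\<Sum>i<n. t i - s i) < \<delta>" for n s t
  proof -
    have "(\<Sum>i<n. dist (F (s i)) (F (t i))) \<le> (\<Sum>i<n. dist (\<gamma> (s i)) (\<gamma> (t i)))"
      by (rule sum_mono) (use that(1) le in auto)
    also have "\<dots> < \<epsilon>" by (intro \<delta>[rule_format]) (use that in auto)
    finally show ?thesis .
  qed
  then show "\<exists>\<delta>>0. \<forall>(n::nat) s t. (\<forall>i<n. a \<le> s i \<and> s i \<le> t i \<and> t i \<le> b) \<and>
     disjoint_family_on (\<lambda>i. {s i<..<t i}) {..<n} \<and> (\<Sum>i<n. t i - s i) < \<delta>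
     \<longrightarrow> (\<Sum>i<n. dist (F (s i)) (F (t i))) < \<epsilon>"
    using \<open>0 < \<delta>\<close> by (intro exI[of _ \<delta>]) simp
qed

text \<open>The definition indexes families by initial segments of the naturals. Arbitrary finite
  index sets let the tagged intervals of a division serve as indices directly.\<close>

lemma abs_cont_on_finite_family:
  assumes "abs_cont_on a b \<gamma>" "0 < \<epsilon>"
  obtains \<delta> where "0 < \<delta>"
    "\<forall>I (s :: 'i \<Rightarrow> real) t. finite I \<and> (\<forall>i\<in>I. a \<le> s i \<and> s i \<le> t i \<and> t i \<le> b) \<and>
      disjoint_family_on (\<lambda>i. {s i<..<t i}) I \<and> (\<Sum>i\<in>I. t i - s i) < \<delta>
      \<longrightarrow> (\<Sum>i\<in>I. dist (\<gamma> (s i)) (\<gamma> (t i))) < \<epsilon>"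
proof -
  obtain \<delta> where "0 < \<delta>" and
    \<delta>: "\<forall>(n::nat) s t. (\<forall>i<n. a \<le> s i \<and> s i \<le> t i \<and> t i \<le> b) \<and>
      disjoint_family_on (\<lambda>i. {s i<..<t i}) {..<n} \<and> (\<Sum>i<n. t i - s i) < \<delta>
      \<longrightarrow> (\<Sum>i<n. dist (\<gamma> (s i)) (\<gamma> (t i))) < \<epsilon>"
    using assms(1)[unfolded abs_cont_on_def, THEN spec, THEN mp, OF assms(2)] by (elim exE conjE) (rule that)
  show ?thesis
  proof (intro that[OF \<open>0 < \<delta>\<close>] allI impI)
    fix I and s t :: "'i \<Rightarrow> real"
    assume "finite I \<and> (\<forall>i\<in>I. a \<le> s i \<and> s i \<le> t i \<and> t i \<le> b) \<and>
      disjoint_family_on (\<lambda>i. {s i<..<t i}) I \<and> (\<Sum>i\<in>I. t i - s i) < \<delta>"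
    then have I: "finite I" "\<And>i. i \<in> I \<Longrightarrow> a \<le> s i \<and> s i \<le> t i \<and> t i \<le> b"
      "disjoint_family_on (\<lambda>i. {s i<..<t i}) I" "(\<Sum>i\<in>I. t i - s i) < \<delta>" by auto
    obtain h where h: "bij_betw h {0..<card I} I" using ex_bij_betw_nat_finite[OF I(1)] by blast
    then have h: "bij_betw h {..<card I} I" by (simp add: atLeast0LessThan)
    have sum: "(\<Sum>i<card I. f (h i)) = sum f I" for f :: "'i \<Rightarrow> real"
      by (rule sum.reindex_bij_betw[OF h])
    have "(\<Sum>i<card I. dist (\<gamma> ((s \<circ> h) i)) (\<gamma> ((t \<circ> h) i))) < \<epsilon>"
    proof (intro \<delta>[rule_format] conjI allI impI)
      show "a \<le> (s \<circ> h) i" "(s \<circ> h) i \<le> (t \<circ> h) i" "(t \<circ> h) i \<le> b" if "i < card I" for i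
        using I(2)[OF bij_betw_apply[OF h, of i]] that by auto
      show "disjoint_family_on (\<lambda>i. {(s \<circ> h) i<..<(t \<circ> h) i}) {..<card I}"
        unfolding disjoint_family_on_def
      proof (intro ballI impI)
        fix i j assume ij: "i \<in> {..<card I}" "j \<in> {..<card I}" "i \<noteq> j"
        then have "h i \<noteq> h j" using h by (auto simp: bij_betw_def inj_on_def)
        then show "{(s \<circ> h) i<..<(t \<circ> h) i} \<inter> {(s \<circ> h) j<..<(t \<circ> h) j} = {}"
          using disjoint_family_onD[OF I(3) bij_betw_apply[OF h ij(1)] bij_betw_apply[OF h ij(2)]] by simp
      qed
      show "(\<Sum>i<card I. (t \<circ> h) i - (s \<circ> h) i) < \<delta>"
        using sum[of "\<lambda>i. t i - s i"] I(4) by simp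
    qed
    then show "(\<Sum>i\<in>I. dist (\<gamma> (s i)) (\<gamma> (t i))) < \<epsilon>"
      using sum[of "\<lambda>i. dist (\<gamma> (s i)) (\<gamma> (t i))"] by simp
  qed
qed

text \<open>With tolerance 1, the cells of any partition of an interval shorter than
  \<open>\<delta>\<close> form an admissible family.\<close>

lemma abs_cont_on_short_bounded_variation:
  assumes "abs_cont_on a b \<gamma>"
  obtains \<delta> where "0 < \<delta>"
    "\<And>c d. a \<le> c \<Longrightarrow> d \<le> b \<Longrightarrow> d - c < \<delta> \<Longrightarrow> bounded_variation_on c d \<gamma>"
proof -
  obtain \<delta> where "0 < \<delta>" and \<delta>:
    "\<forall>I (s :: nat \<Rightarrow> real) t. finite I \<and> (\<forall>i\<in>I. a \<le> s i \<and> s i \<le> t i \<and> t i \<le> b) \<and>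
      disjoint_family_on (\<lambda>i. {s i<..<t i}) I \<and> (\<Sum>i\<in>I. t i - s i) < \<delta>
      \<longrightarrow> (\<Sum>i\<in>I. dist (\<gamma> (s i)) (\<gamma> (t i))) < 1"
    by (rule abs_cont_on_finite_family[OF assms zero_less_one, where 'i = nat])
  show ?thesis
  proof (rule that[OF \<open>0 < \<delta>\<close>])
    fix c d assume cd: "a \<le> c" "d \<le> b" "d - c < \<delta>"
    have "variation_sum \<gamma> n x < 1" if x: "partition_of c d n x" for n x
      unfolding variation_sum_def
    proof (intro \<delta>[rule_format] conjI ballI)
      show "a \<le> x i" "x i \<le> x (Suc i)" "x (Suc i) \<le> b" if "i \<in> {..<n}" for i
        using partition_of_bounds[OF x, of i] partition_of_bounds[OF x, of "Suc i"] partition_of_mono[OF x, of i "Suc i"] that cd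
        by auto
      show "disjoint_family_on (\<lambda>i. {x i<..<x (Suc i)}) {..<n}"
        unfolding disjoint_family_on_def
      proof (intro ballI impI)
        fix i j assume ij: "i \<in> {..<n}" "j \<in> {..<n}" "i \<noteq> j"
        then have "x (Suc i) \<le> x j \<or> x (Suc j) \<le> x i"
          using partition_of_mono[OF x, of "Suc i" j] partition_of_mono[OF x, of "Suc j" i]
          by (cases "i < j") auto
        then show "{x i<..<x (Suc i)} \<inter> {x j<..<x (Suc j)} = {}" by auto
      qed
      have "(\<Sum>i<n. x (Suc i) - x i) = d - c"
        using x by (subst sum_lessThan_telescope) (simp add: partition_of_def)
      then show "(\<Sum>i<n. x (Suc i) - x i) < \<delta>" using cd by simp
    qed simp
    then show "bounded_variation_on c d \<gamma>"
      unfolding bounded_variation_on_def by (meson less_imp_le)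
  qed
qed

text \<open>Bounded variation has been obtained on short intervals, so the exceptional null sets are
  joined by bisection.\<close>

lemma abs_cont_on_real_differentiable_ae:
  fixes F :: "real \<Rightarrow> real"
  assumes F: "abs_cont_on a b F" and "a \<le> b"
  shows "negligible {x \<in> {a<..<b}. \<not> F differentiable (at x)}"
proof -
  \<comment> \<open>Clipping to \<open>{a..b}\<close> is needed because the short intervals in the
    bisection principle may stick out of it.\<close>
  define N where "N c d = {x \<in> {max a c<..<min b d}. \<not> F differentiable (at x)}" for c d
  obtain \<delta> where "0 < \<delta>"
    and \<delta>: "\<And>c d. a \<le> c \<Longrightarrow> d \<le> b \<Longrightarrow> d - c < \<delta> \<Longrightarrow> bounded_variation_on c d F"
    using abs_cont_on_short_bounded_variation[OF F] by blast
  have "negligible (N a b)"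
    using \<open>a \<le> b\<close>
  proof (induction rule: Bolzano)
    case (trans c d e)
    have "N c e \<subseteq> N c d \<union> N d e \<union> {d}" by (auto simp: N_def)
    with trans show ?case by (meson negligible_Un negligible_sing negligible_subset)
  next
    case (local x)
    have "negligible (N c d)" if "c \<le> x \<and> x \<le> d \<and> d - c < \<delta>" for c d
    proof (cases "max a c \<le> min b d")
      case True
      have "bounded_variation_on (max a c) (min b d) F"
        by (rule \<delta>) (use that in auto)
      from bounded_variation_on_differentiable_ae[OF this True] show ?thesis by (simp add: N_def)
    next
      case False
      then have "N c d = {}" by (auto simp: N_def)
      then show ?thesis by simp
    qed
    then show ?case using \<open>0 < \<delta>\<close> by blast
  qed
  then show ?thesis by (simp add: N_def)
qed

lemma abs_cont_on_differentiable_ae: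
  fixes \<gamma> :: "real \<Rightarrow> 'a::euclidean_space"
  assumes "abs_cont_on a b \<gamma>" and "a \<le> b"
  shows "negligible {x \<in> {a<..<b}. \<not> \<gamma> differentiable (at x)}"
proof -
  have "negligible (\<Union>i\<in>Basis. {x \<in> {a<..<b}. \<not> (\<lambda>s. \<gamma> s \<bullet> i) differentiable (at x)})"
  proof (rule negligible_countable_Union[OF countable_image[OF countable_finite[OF finite_Basis]]])
    fix S assume "S \<in> (\<lambda>i. {x \<in> {a<..<b}. \<not> (\<lambda>s. \<gamma> s \<bullet> i) differentiable (at x)}) ` Basis"
    then obtain i :: 'a where i: "i \<in> Basis" "S = {x \<in> {a<..<b}. \<not> (\<lambda>s. \<gamma> s \<bullet> i) differentiable (at x)}" by blast
    have "abs_cont_on a b (\<lambda>s. \<gamma> s \<bullet> i)"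
    proof (rule abs_cont_on_dist_le[OF assms(1)])
      show "dist (\<gamma> s \<bullet> i) (\<gamma> t \<bullet> i) \<le> dist (\<gamma> s) (\<gamma> t)" for s t
        using Basis_le_norm[OF i(1), of "\<gamma> s - \<gamma> t"] by (simp add: dist_norm inner_diff_left)
    qed
    from abs_cont_on_real_differentiable_ae[OF this assms(2)] show "negligible S" using i by simp
  qed
  then show ?thesis
    by (rule negligible_subset) (auto simp: differentiable_componentwise_within[where f = \<gamma>])
qed

text \<open>A gauge argument. Tags in the null set \<open>E\<close> carry the value 0, and their
  intervals lie in an open set so small that absolute continuity bounds the sum of their increments.
  At all other tags the derivative approximates the increment. Integrability of the derivative comes
  out as part of the conclusion.\<close>

theorem abs_cont_on_has_integral_vector_derivative:
  fixes \<gamma> :: "real \<Rightarrow> 'a::euclidean_space"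
  assumes AC: "abs_cont_on a b \<gamma>" and "a \<le> b"
  shows "((\<lambda>s. vector_derivative \<gamma> (at s)) has_integral (\<gamma> b - \<gamma> a)) {a..b}"
proof -
  \<comment> \<open>The endpoints belong to \<open>E\<close> because \<open>at x\<close> is
    two-sided and nothing is assumed of \<open>\<gamma>\<close> outside
    \<open>{a..b}\<close>.\<close>
  define E where "E = {x \<in> {a<..<b}. \<not> \<gamma> differentiable (at x)} \<union> {a, b}"
  define g where "g s = (if s \<in> E then 0 else vector_derivative \<gamma> (at s))" for s
  have E: "negligible E"
    unfolding E_def by (rule negligible_Un[OF abs_cont_on_differentiable_ae[OF assms]]) (simp add: negligible_finite)
  have "(g has_integral (\<gamma> b - \<gamma> a)) {a..b}"
    unfolding has_integral_real
  proof (intro allI impI)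
    fix e :: real assume "0 < e"
    define e' where "e' = e / (2 * (b - a + 1))"
    have e': "0 < e'" "e' * (b - a) < e / 2"
      using \<open>0 < e\<close> \<open>a \<le> b\<close> by (auto simp: e'_def field_simps intro: add_pos_nonneg)
    obtain \<delta> where "0 < \<delta>" and \<delta>:
      "\<forall>I (s :: real \<times> real set \<Rightarrow> real) t. finite I \<and> (\<forall>i\<in>I. a \<le> s i \<and> s i \<le> t i \<and> t i \<le> b) \<and>
      disjoint_family_on (\<lambda>i. {s i<..<t i}) I \<and> (\<Sum>i\<in>I. t i - s i) < \<delta>
      \<longrightarrow> (\<Sum>i\<in>I. dist (\<gamma> (s i)) (\<gamma> (t i))) < e / 2"
      by (rule abs_cont_on_finite_family[OF AC half_gt_zero[OF \<open>0 < e\<close>], where 'i = "real \<times> real set"])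
    obtain U where U: "open U" "E \<subseteq> U" "U \<in> lmeasurable" "measure lebesgue U < \<delta>"
    proof -
      obtain T where T: "open T" "E \<subseteq> T" "T - E \<in> lmeasurable" "emeasure lebesgue (T - E) < ennreal \<delta>"
        using sets_lebesgue_outer_open[OF negligible_imp_sets[OF E] \<open>0 < \<delta>\<close>] by blast
      have TE: "T = (T - E) \<union> E" using T by auto
      have m: "T \<in> lmeasurable"
        using T(3) negligible_imp_measurable[OF E] TE by (metis fmeasurable.Un)
      have "measure lebesgue T = measure lebesgue (T - E)"
        using E by (simp add: measure_Diff_null_set negligible_iff_null_sets T(1) borel_open)
      with T(3,4) have "measure lebesgue T < \<delta>"
        using \<open>0 < \<delta>\<close> by (simp add: emeasure_eq_measure2 ennreal_less_iff)
      with T m that show ?thesis by blast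
    qed
    \<comment> \<open>The radius keeps intervals tagged in \<open>E\<close> inside \<open>U\<close>,
      and makes the linearisation accurate to \<open>e'\<close> at the other tags.\<close>
    have "\<exists>r>0. (x \<in> E \<longrightarrow> ball x r \<subseteq> U) \<and> (x \<in> {a..b} - E \<longrightarrow>
        (\<forall>y. \<bar>y - x\<bar> < r \<longrightarrow> norm (\<gamma> y - \<gamma> x - (y - x) *\<^sub>R g x) \<le> e' * \<bar>y - x\<bar>))" for x
    proof (cases "x \<in> {a..b} - E")
      case True
      then have "\<gamma> differentiable (at x)" by (auto simp: E_def)
      then have "(\<gamma> has_vector_derivative g x) (at x)"
        using True by (simp add: g_def vector_derivative_works)
      then have "\<exists>r>0. \<forall>y. \<bar>y - x\<bar> < r \<longrightarrow> norm (\<gamma> y - \<gamma> x - (y - x) *\<^sub>R g x) \<le> e' * \<bar>y - x\<bar>"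
        unfolding has_vector_derivative_def has_derivative_at_alt using e' by auto
      then show ?thesis using True by auto
    next
      case False
      show ?thesis
      proof (cases "x \<in> E")
        case True
        then obtain r where "0 < r" "ball x r \<subseteq> U" using U by (meson openE subsetD)
        then show ?thesis using False by blast
      qed (use False in \<open>auto intro: exI[of _ 1]\<close>)
    qed
    then obtain r where r: "\<And>x. 0 < r x" "\<And>x. x \<in> E \<Longrightarrow> ball x (r x) \<subseteq> U"
      "\<And>x y. x \<in> {a..b} - E \<Longrightarrow> \<bar>y - x\<bar> < r x \<Longrightarrow> norm (\<gamma> y - \<gamma> x - (y - x) *\<^sub>R g x) \<le> e' * \<bar>y - x\<bar>"
      by metis
    show "\<exists>d. gauge d \<and> (\<forall>p. p tagged_division_of {a..b} \<and> d fine p \<longrightarrow>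
        norm ((\<Sum>(x, K)\<in>p. measure lborel K *\<^sub>R g x) - (\<gamma> b - \<gamma> a)) < e)"
    proof (intro exI conjI allI impI)
      show "gauge (\<lambda>x. ball x (r x))" using r(1) gauge_ball_dependent by blast
      fix p assume p: "p tagged_division_of {a..b} \<and> (\<lambda>x. ball x (r x)) fine p"
      then have ptag: "p tagged_division_of {a..b}" and fine: "(\<lambda>x. ball x (r x)) fine p" by auto
      have finp: "finite p" using ptag by blast
      have tag: "Inf K \<le> x \<and> x \<le> Sup K \<and> a \<le> Inf K \<and> Sup K \<le> b \<and> K = {Inf K..Sup K} \<and> K \<subseteq> ball x (r x)"
        if xK: "(x, K) \<in> p" for x K
      proof -
        obtain u v where uv: "K = {u..v}" using tagged_division_ofD(4)[OF ptag xK] by auto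
        have x: "x \<in> K" using tagged_division_ofD(2)[OF ptag that] .
        then have "u \<le> v" using uv by auto
        moreover have "K \<subseteq> {a..b}" using tagged_division_ofD(3)[OF ptag that] .
        ultimately show ?thesis using uv x fine that by (auto simp: fine_def)
      qed
      have err: "norm (measure lborel K *\<^sub>R g x - (\<gamma> (Sup K) - \<gamma> (Inf K)))
          \<le> (if x \<in> E then dist (\<gamma> (Inf K)) (\<gamma> (Sup K)) else e' * (Sup K - Inf K))" if "(x, K) \<in> p" for x K
      proof (cases "x \<in> E")
        case True
        then show ?thesis by (simp add: g_def dist_norm norm_minus_commute)
      next
        case False
        note t = tag[OF that]
        define u v where "u = Inf K" and "v = Sup K"
        have uv: "u \<le> x" "x \<le> v" "a \<le> u" "v \<le> b" "K = {u..v}" "K \<subseteq> ball x (r x)" using t by (auto simp: u_def v_def)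
        have "u \<in> K" "v \<in> K" using uv by auto
        then have "\<bar>u - x\<bar> < r x" "\<bar>v - x\<bar> < r x" using uv(6) by (auto simp: dist_real_def abs_minus_commute subset_iff)
        then have 1: "norm (\<gamma> u - \<gamma> x - (u - x) *\<^sub>R g x) \<le> e' * \<bar>u - x\<bar>" "norm (\<gamma> v - \<gamma> x - (v - x) *\<^sub>R g x) \<le> e' * \<bar>v - x\<bar>"
          using uv False by (auto intro!: r(3) simp del: abs_of_nonneg abs_of_nonpos)
        \<comment> \<open>The error is the difference of the linearisation errors at the two ends;
          since the tag lies between them, their distances to it add up to the length of
          \<open>K\<close>.\<close>
        have "measure lborel K *\<^sub>R g x - (\<gamma> v - \<gamma> u)
            = (\<gamma> u - \<gamma> x - (u - x) *\<^sub>R g x) - (\<gamma> v - \<gamma> x - (v - x) *\<^sub>R g x)"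
          using uv by (simp add: algebra_simps)
        also have "norm \<dots> \<le> e' * \<bar>u - x\<bar> + e' * \<bar>v - x\<bar>"
          by (rule order_trans[OF norm_triangle_ineq4 add_mono[OF 1]])
        also have "\<dots> = e' * (v - u)" using uv by (simp add: algebra_simps)
        finally show ?thesis using False by (simp add: u_def v_def)
      qed
      define D where "D = {i \<in> p. fst i \<in> E}"
      define s :: "real \<times> real set \<Rightarrow> real" where "s i = Inf (snd i)" for i
      define t :: "real \<times> real set \<Rightarrow> real" where "t i = Sup (snd i)" for i
      have finD: "finite D" using finp by (simp add: D_def)
      have Dtag: "a \<le> s i \<and> s i \<le> t i \<and> t i \<le> b" if "i \<in> p" for i
        using tag[of "fst i" "snd i"] that by (auto simp: s_def t_def)
      have disjp: "disjoint_family_on (\<lambda>i. {s i<..<t i}) p"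
        unfolding disjoint_family_on_def
      proof (intro ballI impI)
        fix i j assume ij: "i \<in> p" "j \<in> p" "i \<noteq> j"
        have "interior (snd i) \<inter> interior (snd j) = {}"
          using tagged_division_ofD(5)[OF ptag, of "fst i" "snd i" "fst j" "snd j"] ij by (auto simp: prod_eq_iff)
        moreover have "interior (snd i) = {s i<..<t i}" "interior (snd j) = {s j<..<t j}"
          using tag[of "fst i" "snd i"] tag[of "fst j" "snd j"] ij interior_atLeastAtMost_real by (metis s_def t_def prod.collapse)+
        ultimately show "{s i<..<t i} \<inter> {s j<..<t j} = {}" by simp
      qed
      then have disjD: "disjoint_family_on (\<lambda>i. {s i<..<t i}) D"
        by (rule disjoint_family_on_mono[rotated]) (auto simp: D_def)
      have "(\<Sum>i\<in>D. t i - s i) = (\<Sum>i\<in>D. measure lebesgue {s i<..<t i})"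
        by (rule sum.cong) (use Dtag D_def in auto)
      also have "\<dots> = measure lebesgue (\<Union>i\<in>D. {s i<..<t i})"
        by (rule measure_UNION'[symmetric]) (use finD disjD in \<open>auto simp: pairwise_def disjnt_def disjoint_family_on_def\<close>)
      also have "\<dots> \<le> measure lebesgue U"
      proof (rule measure_mono_fmeasurable)
        show "(\<Union>i\<in>D. {s i<..<t i}) \<subseteq> U"
        proof
          fix y assume "y \<in> (\<Union>i\<in>D. {s i<..<t i})"
          then obtain x K where xK: "(x, K) \<in> p" "x \<in> E" "y \<in> {Inf K<..<Sup K}" by (auto simp: D_def s_def t_def)
          then have "y \<in> ball x (r x)" using tag[OF xK(1)] by fastforce
          then show "y \<in> U" using r(2)[OF xK(2)] by blast
        qed
      qed (use U finD in \<open>auto intro!: sets.finite_UN\<close>)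
      finally have sumD: "(\<Sum>i\<in>D. t i - s i) < \<delta>" using U by simp
      \<comment> \<open>Here absolute continuity enters beyond differentiability almost everywhere;
        for the Cantor function this sum would not be small.\<close>
      have bad: "(\<Sum>i\<in>D. dist (\<gamma> (s i)) (\<gamma> (t i))) < e / 2"
        by (intro \<delta>[rule_format] conjI) (use finD disjD sumD Dtag in \<open>auto simp: D_def\<close>)
      have good: "(\<Sum>i\<in>p - D. e' * (t i - s i)) \<le> e' * (b - a)"
      proof -
        have "(\<Sum>i\<in>p - D. e' * (t i - s i)) \<le> (\<Sum>i\<in>p. e' * (t i - s i))"
          by (rule sum_mono2) (use finp e' Dtag in auto)
        also have "\<dots> = e' * (\<Sum>(x, K)\<in>p. Sup K - Inf K)"
          by (simp add: s_def t_def sum_distrib_left split_beta)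
        also have "(\<Sum>(x, K)\<in>p. Sup K - Inf K) = b - a"
          using additive_tagged_division_1[OF \<open>a \<le> b\<close> ptag, of "\<lambda>x. x"] .
        finally show ?thesis .
      qed
      have "(\<Sum>(x, K)\<in>p. measure lborel K *\<^sub>R g x) - (\<gamma> b - \<gamma> a)
          = (\<Sum>(x, K)\<in>p. measure lborel K *\<^sub>R g x - (\<gamma> (Sup K) - \<gamma> (Inf K)))"
        unfolding additive_tagged_division_1[OF \<open>a \<le> b\<close> ptag, of \<gamma>, symmetric]
        by (simp add: sum_subtractf split_beta)
      also have "norm \<dots> \<le> (\<Sum>i\<in>p. if i \<in> D then dist (\<gamma> (s i)) (\<gamma> (t i)) else e' * (t i - s i))"
      proof (rule sum_norm_le)
        fix i assume i: "i \<in> p"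
        then show "norm (case i of (x, K) \<Rightarrow> measure lborel K *\<^sub>R g x - (\<gamma> (Sup K) - \<gamma> (Inf K)))
            \<le> (if i \<in> D then dist (\<gamma> (s i)) (\<gamma> (t i)) else e' * (t i - s i))"
          using err[of "fst i" "snd i"] by (simp add: D_def s_def t_def split_beta split: if_splits)
      qed
      also have "\<dots> = (\<Sum>i\<in>D. dist (\<gamma> (s i)) (\<gamma> (t i))) + (\<Sum>i\<in>p - D. e' * (t i - s i))"
      proof -
        have "p \<inter> {i. i \<in> D} = D" "p \<inter> - {i. i \<in> D} = p - D" by (auto simp: D_def)
        then show ?thesis by (simp add: sum.If_cases[OF finp])
      qed
      also have "\<dots> < e" using bad good e' by simp
      finally show "norm ((\<Sum>(x, K)\<in>p. measure lborel K *\<^sub>R g x) - (\<gamma> b - \<gamma> a)) < e" .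
    qed
  qed
  then show ?thesis
    by (rule has_integral_spike[OF E, where f = g, rotated]) (simp add: g_def)
qed

section \<open>Continuity, stopping and measurability for absolutely continuous curves\<close>

lemma abs_cont_on_imp_continuous_on:
  assumes "abs_cont_on a b \<gamma>"
  shows "continuous_on {a..b} \<gamma>"
  unfolding continuous_on_iff
proof (intro ballI allI impI)
  fix x \<epsilon> :: real assume x: "x \<in> {a..b}" and "0 < \<epsilon>"
  obtain \<delta> where "0 < \<delta>" and \<delta>:
    "\<forall>I (s :: unit \<Rightarrow> real) t. finite I \<and> (\<forall>i\<in>I. a \<le> s i \<and> s i \<le> t i \<and> t i \<le> b) \<and>
      disjoint_family_on (\<lambda>i. {s i<..<t i}) I \<and> (\<Sum>i\<in>I. t i - s i) < \<delta>
      \<longrightarrow> (\<Sum>i\<in>I. dist (\<gamma> (s i)) (\<gamma> (t i))) < \<epsilon>"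
    by (rule abs_cont_on_finite_family[OF assms \<open>0 < \<epsilon>\<close>, where 'i = unit])
  have close: "dist (\<gamma> s) (\<gamma> t) < \<epsilon>" if "a \<le> s" "s \<le> t" "t \<le> b" "t - s < \<delta>" for s t
    using \<delta>[THEN spec[of _ "{()}"], THEN spec[of _ "\<lambda>_. s"], THEN spec[of _ "\<lambda>_. t"]] that
    by (simp add: disjoint_family_on_def)
  have "dist (\<gamma> y) (\<gamma> x) < \<epsilon>" if "y \<in> {a..b}" "dist y x < \<delta>" for y
    using close[of x y] close[of y x] x that by (cases "y \<le> x") (auto simp: dist_real_def dist_commute)
  then show "\<exists>d>0. \<forall>x'\<in>{a..b}. dist x' x < d \<longrightarrow> dist (\<gamma> x') (\<gamma> x) < \<epsilon>"
    using \<open>0 < \<delta>\<close> by blast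
qed

text \<open>The map \<open>\<lambda>t. min t a\<close> is monotone and does not expand lengths, so
  it carries admissible families to admissible families. The stopped curve is the competitor for a
  minimizing curve.\<close>

lemma abs_cont_on_stopped:
  assumes "abs_cont_on 0 T \<gamma>" "0 \<le> a"
  shows "abs_cont_on 0 T (\<lambda>t. \<gamma> (min t a))"
  unfolding abs_cont_on_def
proof (intro allI impI)
  fix \<epsilon> :: real assume "0 < \<epsilon>"
  obtain \<delta> where "0 < \<delta>" and
    \<delta>: "\<forall>(n::nat) s t. (\<forall>i<n. 0 \<le> s i \<and> s i \<le> t i \<and> t i \<le> T) \<and>
      disjoint_family_on (\<lambda>i. {s i<..<t i}) {..<n} \<and> (\<Sum>i<n. t i - s i) < \<delta>
      \<longrightarrow> (\<Sum>i<n. dist (\<gamma> (s i)) (\<gamma> (t i))) < \<epsilon>"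
    using assms(1)[unfolded abs_cont_on_def, THEN spec, THEN mp, OF \<open>0 < \<epsilon>\<close>] by (elim exE conjE) (rule that)
  show "\<exists>\<delta>>0. \<forall>(n::nat) s t. (\<forall>i<n. 0 \<le> s i \<and> s i \<le> t i \<and> t i \<le> T) \<and>
     disjoint_family_on (\<lambda>i. {s i<..<t i}) {..<n} \<and> (\<Sum>i<n. t i - s i) < \<delta>
     \<longrightarrow> (\<Sum>i<n. dist (\<gamma> (min (s i) a)) (\<gamma> (min (t i) a))) < \<epsilon>"
  proof (intro exI[of _ \<delta>] conjI allI impI \<open>0 < \<delta>\<close>)
    fix n :: nat and s t :: "nat \<Rightarrow> real"
    assume st: "(\<forall>i<n. 0 \<le> s i \<and> s i \<le> t i \<and> t i \<le> T) \<and>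
      disjoint_family_on (\<lambda>i. {s i<..<t i}) {..<n} \<and> (\<Sum>i<n. t i - s i) < \<delta>"
    have "\<forall>i<n. 0 \<le> min (s i) a \<and> min (s i) a \<le> min (t i) a \<and> min (t i) a \<le> T"
      using st assms(2) by (auto simp: min_le_iff_disj)
    moreover have "disjoint_family_on (\<lambda>i. {min (s i) a<..<min (t i) a}) {..<n}"
    proof -
      have "{min (s i) a<..<min (t i) a} \<subseteq> {s i<..<t i}" for i by (auto simp: min_less_iff_disj)
      then show ?thesis using st by (fastforce simp: disjoint_family_on_def)
    qed
    moreover have "(\<Sum>i<n. min (t i) a - min (s i) a) < \<delta>"
    proof -
      have "(\<Sum>i<n. min (t i) a - min (s i) a) \<le> (\<Sum>i<n. t i - s i)"
        by (rule sum_mono) (use st in \<open>auto simp: min_def\<close>)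
      then show ?thesis using st by simp
    qed
    ultimately show "(\<Sum>i<n. dist (\<gamma> (min (s i) a)) (\<gamma> (min (t i) a))) < \<epsilon>"
      using \<delta>[THEN spec[of _ n], THEN spec[of _ "\<lambda>i. min (s i) a"], THEN spec[of _ "\<lambda>i. min (t i) a"]] by simp
  qed
qed

lemma AC_curves_stopped:
  assumes "\<gamma> \<in> AC_curves S" "0 \<le> a"
  shows "(\<lambda>t. \<gamma> (min t a)) \<in> AC_curves S"
  using assms by (simp add: AC_curves_def abs_cont_on_stopped)

lemma AC_curves_continuous_on:
  assumes "\<gamma> \<in> AC_curves S"
  shows "continuous_on {0..} \<gamma>"
  unfolding continuous_on_eq_continuous_within
proof
  fix t :: real assume t: "t \<in> {0..}"
  have "continuous_on {0..t+1} \<gamma>"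
    using assms t by (intro abs_cont_on_imp_continuous_on) (simp add: AC_curves_def)
  then have "continuous (at t within {0..t+1}) \<gamma>"
    using t by (simp add: continuous_on_eq_continuous_within)
  moreover have "at t within {0..t+1} = at t within {0..}"
    by (rule at_within_nhd[of _ "{..<t+1}"]) auto
  ultimately show "continuous (at t within {0..}) \<gamma>" by simp
qed

text \<open>Having an integral over each \<open>{0..real n}\<close> makes the derivative measurable
  there, whatever its unspecified values at exceptional points; the truncations converge
  pointwise.\<close>

lemma AC_curves_vector_derivative_measurable:
  fixes \<gamma> :: "real \<Rightarrow> 'a::euclidean_space"
  assumes "\<gamma> \<in> AC_curves S"
  shows "(\<lambda>s. vector_derivative \<gamma> (at s)) \<in> borel_measurable (lebesgue_on {0..})"
proof -
  let ?v = "\<lambda>s. vector_derivative \<gamma> (at s)"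
  have "(\<lambda>s. indicator {0..} s *\<^sub>R ?v s) \<in> borel_measurable lebesgue"
  proof (rule borel_measurable_LIMSEQ_metric)
    fix n :: nat
    have "(?v has_integral (\<gamma> (real n) - \<gamma> 0)) {0..real n}"
      using assms by (intro abs_cont_on_has_integral_vector_derivative) (simp_all add: AC_curves_def)
    then show "(\<lambda>s. indicator {0..real n} s *\<^sub>R ?v s) \<in> borel_measurable lebesgue"
      by (rule has_integral_implies_lebesgue_measurable)
  next
    fix s :: real
    obtain N where N: "s \<le> real N" using real_arch_simple by blast
    have "\<forall>\<^sub>F n in sequentially. indicator {0..real n} s *\<^sub>R ?v s = indicator {0..} s *\<^sub>R ?v s"
      using eventually_ge_at_top[of N] by eventually_elim (use N in \<open>auto simp: indicator_def\<close>)
    then show "(\<lambda>n. indicator {0..real n} s *\<^sub>R ?v s) \<longlonglongrightarrow> indicator {0..} s *\<^sub>R ?v s"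
      by (rule tendsto_eventually)
  qed
  then show ?thesis by (subst borel_measurable_restrict_space_iff) auto
qed

lemma running_cost_measurable:
  fixes \<gamma> :: "real \<Rightarrow> 'a::euclidean_space"
  assumes AC: "\<gamma> \<in> AC_curves S" and f: "continuous_on S f"
  shows "running_cost p q f \<gamma> \<in> borel_measurable (lebesgue_on {0..})"
proof -
  let ?L = "lebesgue_on {0..} :: real measure"
  have [measurable]: "(\<lambda>s. vector_derivative \<gamma> (at s)) \<in> borel_measurable ?L"
    by (rule AC_curves_vector_derivative_measurable[OF AC])
  have "continuous_on {0..} (\<lambda>s. f (\<gamma> s))"
    using AC by (intro continuous_on_compose2[OF f] AC_curves_continuous_on[OF AC]) (auto simp: AC_curves_def)
  then have [measurable]: "(\<lambda>s. f (\<gamma> s)) \<in> borel_measurable ?L"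
    by (rule continuous_imp_measurable_on_sets_lebesgue) simp
  have [measurable]: "(\<lambda>s. exp (- s)) \<in> borel_measurable ?L"
    by (rule continuous_imp_measurable_on_sets_lebesgue) (auto intro!: continuous_intros)
  show ?thesis unfolding running_cost_def by measurable
qed

subsection \<open>Cost of a minimizing curve\<close>

lemma nn_integral_exp_minus_atLeast:
  "(\<integral>\<^sup>+s\<in>{a..}. ennreal (exp (- s)) \<partial>lebesgue) = ennreal (exp (- a))"
proof -
  have "((\<lambda>s::real. - exp (- s)) \<longlongrightarrow> - 0) at_top"
    by (intro tendsto_minus filterlim_compose[OF exp_at_bot] filterlim_uminus_at_bot_at_top)
  then have "(\<integral>\<^sup>+s\<in>{a..}. ennreal (exp (- s)) \<partial>lborel) = ennreal (0 - (- exp (- a)))"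
    by (intro nn_integral_FTC_atLeast) (auto intro!: derivative_eq_intros)
  then show ?thesis by (simp add: nn_integral_completion)
qed

text \<open>Discounting has total mass 1, so adding a constant to \<open>f\<close> adds it to the cost.\<close>

lemma cost_eq_shifted:
  fixes \<gamma> :: "real \<Rightarrow> 'a::euclidean_space"
  assumes AC: "\<gamma> \<in> AC_curves S" and f: "continuous_on S f" and m: "\<And>y. y \<in> S \<Longrightarrow> m \<le> f y" and "0 < q"
  shows "cost p q f \<gamma> = enn2ereal (\<integral>\<^sup>+s\<in>{0..}. ennreal (running_cost p q (\<lambda>y. f y - m) \<gamma> s) \<partial>lebesgue) + ereal m"
proof -
  let ?L = "lebesgue_on {0..} :: real measure"
  define R where "R = running_cost p q f \<gamma>"
  define A where "A = running_cost p q (\<lambda>y. f y - m) \<gamma>"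
  have RA: "R s = A s + m * exp (- s)" for s by (simp add: R_def A_def running_cost_def algebra_simps)
  have nonneg: "0 \<le> A s" if "s \<in> {0..}" for s
    using m[of "\<gamma> s"] AC that \<open>0 < q\<close> by (simp add: A_def running_cost_def AC_curves_def)
  have [measurable]: "(\<lambda>s. exp (- s)) \<in> borel_measurable ?L"
    by (rule continuous_imp_measurable_on_sets_lebesgue) (auto intro!: continuous_intros)
  have [measurable]: "R \<in> borel_measurable ?L"
    unfolding R_def by (rule running_cost_measurable[OF AC f])
  have [measurable]: "A \<in> borel_measurable ?L"
    unfolding A_def by (intro running_cost_measurable[OF AC] continuous_intros f)
  have on: "(\<integral>\<^sup>+s\<in>{0..}. h s \<partial>lebesgue) = (\<integral>\<^sup>+s. h s \<partial>?L)" for h :: "real \<Rightarrow> ennreal"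
    by (subst nn_integral_restrict_space) auto
  have mass: "(\<integral>\<^sup>+s. ennreal (c * exp (- s)) \<partial>?L) = ennreal c" for c
  proof (cases "0 \<le> c")
    case True
    have "(\<integral>\<^sup>+s. ennreal (c * exp (- s)) \<partial>?L) = ennreal c * (\<integral>\<^sup>+s. ennreal (exp (- s)) \<partial>?L)"
      using True by (subst nn_integral_cmult[symmetric]) (auto simp: ennreal_mult)
    also have "(\<integral>\<^sup>+s. ennreal (exp (- s)) \<partial>?L) = 1"
      unfolding on[symmetric] by (subst nn_integral_exp_minus_atLeast) simp
    finally show ?thesis by simp
  next
    case False
    then have "ennreal (c * exp (- s)) = 0" for s by (intro ennreal_neg) (auto simp: mult_le_0_iff)
    then show ?thesis using False by (simp add: ennreal_neg)
  qed
  \<comment> \<open>This is \<open>RA\<close> split into positive and negative parts and rearranged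
    so that every term is nonnegative, since subtraction in \<open>ennreal\<close>
    truncates.\<close>
  have pt: "ennreal (R s) + ennreal (- m * exp (- s)) = ennreal (A s) + (ennreal (m * exp (- s)) + ennreal (- R s))"
    if "s \<in> {0..}" for s
  proof (cases "0 \<le> m")
    case True
    then have "0 \<le> m * exp (- s)" "0 \<le> R s" using nonneg[OF that] RA[of s] by auto
    then show ?thesis using nonneg[OF that] RA[of s] by (simp add: ennreal_neg flip: ennreal_plus)
  next
    case False
    then have "m * exp (- s) \<le> 0" by (simp add: mult_le_0_iff)
    then show ?thesis
      using nonneg[OF that] RA[of s] by (cases "0 \<le> R s") (simp_all add: ennreal_neg flip: ennreal_plus)
  qed
  have "(\<integral>\<^sup>+s. ennreal (R s) \<partial>?L) + ennreal (- m)
      = (\<integral>\<^sup>+s. ennreal (R s) + ennreal (- m * exp (- s)) \<partial>?L)"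
    using mass[of "- m"] by (subst nn_integral_add) auto
  also have "\<dots> = (\<integral>\<^sup>+s. ennreal (A s) + (ennreal (m * exp (- s)) + ennreal (- R s)) \<partial>?L)"
    by (rule nn_integral_cong) (use pt in simp)
  also have "\<dots> = (\<integral>\<^sup>+s. ennreal (A s) \<partial>?L) + (ennreal m + (\<integral>\<^sup>+s. ennreal (- R s) \<partial>?L))"
    using mass[of m] by (subst nn_integral_add; simp?)+
  finally have eq: "(\<integral>\<^sup>+s. ennreal (R s) \<partial>?L) + ennreal (- m)
      = (\<integral>\<^sup>+s. ennreal (A s) \<partial>?L) + (ennreal m + (\<integral>\<^sup>+s. ennreal (- R s) \<partial>?L))" .
  \<comment> \<open>As \<open>A\<close> is nonnegative, the negative part of \<open>R\<close> is at
    most that of \<open>m * exp (- s)\<close>; its finite integral makes the difference in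
    \<open>cost\<close> meaningful.\<close>
  have "(\<integral>\<^sup>+s. ennreal (- R s) \<partial>?L) \<le> (\<integral>\<^sup>+s. ennreal (- m * exp (- s)) \<partial>?L)"
    by (rule nn_integral_mono) (use nonneg RA in \<open>auto intro!: ennreal_leI\<close>)
  then have fin: "(\<integral>\<^sup>+s. ennreal (- R s) \<partial>?L) < \<infinity>"
    unfolding mass by (simp add: le_less_trans)
  have "enn2ereal (\<integral>\<^sup>+s. ennreal (R s) \<partial>?L) - enn2ereal (\<integral>\<^sup>+s. ennreal (- R s) \<partial>?L)
      = enn2ereal (\<integral>\<^sup>+s. ennreal (A s) \<partial>?L) + ereal m"
  proof -
    obtain N where N: "(\<integral>\<^sup>+s. ennreal (- R s) \<partial>?L) = ennreal N" "0 \<le> N"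
      using fin by (cases "\<integral>\<^sup>+s. ennreal (- R s) \<partial>?L") auto
    show ?thesis
    proof (cases "\<integral>\<^sup>+s. ennreal (A s) \<partial>?L")
      case top
      then have "(\<integral>\<^sup>+s. ennreal (R s) \<partial>?L) = top"
        using eq by (cases "\<integral>\<^sup>+s. ennreal (R s) \<partial>?L") (auto simp flip: ennreal_plus)
      then show ?thesis using top N by simp
    next
      case (real r)
      have "(\<integral>\<^sup>+s. ennreal (R s) \<partial>?L) \<noteq> top"
      proof
        assume "(\<integral>\<^sup>+s. ennreal (R s) \<partial>?L) = top"
        then have "ennreal r + (ennreal m + ennreal N) = top" using eq real N by simp
        then show False by (metis ennreal_add_eq_top ennreal_neq_top)
      qed
      then obtain P where P: "(\<integral>\<^sup>+s. ennreal (R s) \<partial>?L) = ennreal P" "0 \<le> P"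
        by (cases "\<integral>\<^sup>+s. ennreal (R s) \<partial>?L") auto
      have "ennreal P + ennreal (- m) = ennreal r + (ennreal m + ennreal N)"
        using eq N real P by simp
      then have "P = r + m + N"
        using P(2) N(2) real(1) by (cases "0 \<le> m") (simp_all add: ennreal_neg flip: ennreal_plus)
      then show ?thesis using P N real by simp
    qed
  qed
  then show ?thesis by (simp add: cost_def on R_def A_def)
qed

text \<open>Resting at \<open>\<xi> a\<close> from time \<open>a\<close> on costs the right-hand
  side, with no kinetic part. Both curves agree before \<open>a\<close>, and that part of the cost
  cancels once it is known to be finite.\<close>

lemma minimizing_curve_tail_le:
  fixes \<Omega> :: "'a::euclidean_space set"
  assumes min: "minimizing_curve \<Omega> p q f x \<xi>" and f: "continuous_on (closure \<Omega>) f"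
    and m: "\<And>y. y \<in> closure \<Omega> \<Longrightarrow> m \<le> f y" and "0 < q" and "0 \<le> a"
  shows "(\<integral>\<^sup>+s\<in>{a..}. ennreal (running_cost p q (\<lambda>y. f y - m) \<xi> s) \<partial>lebesgue)
    \<le> ennreal (exp (- a) * (f (\<xi> a) - m))"
proof -
  let ?R = "\<lambda>\<gamma> s. ennreal (running_cost p q (\<lambda>y. f y - m) \<gamma> s)"
  have AC: "\<xi> \<in> AC_curves (closure \<Omega>)" and x: "\<xi> 0 = x" using min by (auto simp: minimizing_curve_def)
  have meas: "(\<lambda>s. ?R \<xi> s * indicator {0..} s) \<in> borel_measurable lebesgue"
  proof -
    have "?R \<xi> \<in> borel_measurable (lebesgue_on {0..})"
      by (intro measurable_compose[OF _ measurable_ennreal] running_cost_measurable[OF AC] continuous_intros f)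
    then show ?thesis by (subst (asm) borel_measurable_restrict_space_iff_ennreal) auto
  qed
  have meas_sub: "(\<lambda>s. ?R \<xi> s * indicator T s) \<in> borel_measurable lebesgue" if "T \<subseteq> {0..}" "T \<in> sets lebesgue" for T
  proof -
    have "(\<lambda>s. (?R \<xi> s * indicator {0..} s) * indicator T s) \<in> borel_measurable lebesgue"
      using that(2) by (intro borel_measurable_times_ennreal meas borel_measurable_indicator)
    moreover have "(\<lambda>s. (?R \<xi> s * indicator {0..} s) * indicator T s) = (\<lambda>s. ?R \<xi> s * indicator T s)"
      using that(1) by (auto simp: indicator_def fun_eq_iff)
    ultimately show ?thesis by simp
  qed
  \<comment> \<open>Used twice: \<open>b = 0\<close> shows that the total cost is finite,
    \<open>b = a\<close> gives the bound itself.\<close>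
  have stop: "(\<integral>\<^sup>+s\<in>{0..}. ?R \<xi> s \<partial>lebesgue)
      \<le> (\<integral>\<^sup>+s\<in>{0..<b}. ?R \<xi> s \<partial>lebesgue) + ennreal (exp (- b) * (f (\<xi> b) - m))" if "0 \<le> b" for b
  proof -
    have meas_exp: "(\<lambda>s. ennreal (exp (- s)) * indicator {b..} s) \<in> borel_measurable lebesgue"
      by (rule measurable_completion) measurable
    define \<eta> where "\<eta> t = \<xi> (min t b)" for t
    have \<eta>: "\<eta> \<in> AC_curves (closure \<Omega>)" unfolding \<eta>_def by (rule AC_curves_stopped[OF AC that])
    have "\<eta> 0 = x" using that x by (simp add: \<eta>_def)
    then have "cost p q f \<xi> \<le> cost p q f \<eta>"
      using min \<eta> unfolding minimizing_curve_def by (auto intro: INF_lower)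
    then have "(\<integral>\<^sup>+s\<in>{0..}. ?R \<xi> s \<partial>lebesgue) \<le> (\<integral>\<^sup>+s\<in>{0..}. ?R \<eta> s \<partial>lebesgue)"
      by (simp add: cost_eq_shifted[OF AC f m \<open>0 < q\<close>] cost_eq_shifted[OF \<eta> f m \<open>0 < q\<close>]
          ereal_add_le_add_iff2 less_eq_ennreal.rep_eq)
    also have "\<dots> \<le> (\<integral>\<^sup>+s. ?R \<xi> s * indicator {0..<b} s
        + ennreal (f (\<xi> b) - m) * (ennreal (exp (- s)) * indicator {b..} s) \<partial>lebesgue)"
    proof (rule nn_integral_mono_AE)
      \<comment> \<open>The stopped curve may have a kink at \<open>b\<close>, so the pointwise
        comparison leaves that time out.\<close>
      have "AE s in lebesgue. s \<noteq> b" by (rule AE_completion[OF AE_lborel_singleton])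
      then show "AE s in lebesgue. ?R \<eta> s * indicator {0..} s \<le> ?R \<xi> s * indicator {0..<b} s
          + ennreal (f (\<xi> b) - m) * (ennreal (exp (- s)) * indicator {b..} s)"
      proof eventually_elim
        fix s :: real assume "s \<noteq> b"
        show "?R \<eta> s * indicator {0..} s \<le> ?R \<xi> s * indicator {0..<b} s
          + ennreal (f (\<xi> b) - m) * (ennreal (exp (- s)) * indicator {b..} s)"
        proof (cases "s < b")
          case True
          have "\<forall>\<^sub>F t in nhds s. t \<in> {..<b}" by (rule eventually_nhds_in_open) (use True in auto)
          then have "\<forall>\<^sub>F t in nhds s. t \<in> UNIV \<longrightarrow> \<eta> t = \<xi> t"
            by eventually_elim (simp add: \<eta>_def min_def)
          then have "vector_derivative \<eta> (at s) = vector_derivative \<xi> (at s)"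
            by (intro vector_derivative_cong_eq) auto
          moreover have "\<eta> s = \<xi> s" using True by (simp add: \<eta>_def min_def)
          ultimately show ?thesis using True by (auto simp: running_cost_def indicator_def)
        next
          case False
          then have "b < s" using \<open>s \<noteq> b\<close> by simp
          have "\<forall>\<^sub>F t in nhds s. t \<in> {b<..}" by (rule eventually_nhds_in_open) (use \<open>b < s\<close> in auto)
          then have "\<forall>\<^sub>F t in nhds s. t \<in> UNIV \<longrightarrow> \<eta> t = \<xi> b"
            by eventually_elim (simp add: \<eta>_def min_def)
          then have "vector_derivative \<eta> (at s) = vector_derivative (\<lambda>t. \<xi> b) (at s)"
            by (intro vector_derivative_cong_eq) auto
          then have vd: "vector_derivative \<eta> (at s) = 0" by simp
          have "\<eta> s = \<xi> b" using \<open>b < s\<close> by (simp add: \<eta>_def min_def)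
          moreover have "0 \<le> f (\<xi> b) - m" using m[of "\<xi> b"] AC that by (simp add: AC_curves_def)
          ultimately have "?R \<eta> s = ennreal (f (\<xi> b) - m) * ennreal (exp (- s))"
            using vd \<open>0 < q\<close> by (simp add: running_cost_def mult.commute flip: ennreal_mult)
          then show ?thesis using \<open>b < s\<close> by (auto simp: indicator_def)
        qed
      qed
    qed
    also have "\<dots> = (\<integral>\<^sup>+s\<in>{0..<b}. ?R \<xi> s \<partial>lebesgue)
        + (\<integral>\<^sup>+s. ennreal (f (\<xi> b) - m) * (ennreal (exp (- s)) * indicator {b..} s) \<partial>lebesgue)"
      by (intro nn_integral_add meas_sub borel_measurable_times_ennreal meas_exp) auto
    also have "(\<integral>\<^sup>+s. ennreal (f (\<xi> b) - m) * (ennreal (exp (- s)) * indicator {b..} s) \<partial>lebesgue)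
        = ennreal (f (\<xi> b) - m) * ennreal (exp (- b))"
      by (simp only: nn_integral_cmult[OF meas_exp] nn_integral_exp_minus_atLeast)
    also have "\<dots> = ennreal (exp (- b) * (f (\<xi> b) - m))"
      using m[of "\<xi> b"] AC that by (simp add: AC_curves_def mult.commute flip: ennreal_mult)
    finally show ?thesis .
  qed
  have split: "(\<integral>\<^sup>+s\<in>{0..}. ?R \<xi> s \<partial>lebesgue)
      = (\<integral>\<^sup>+s\<in>{0..<a}. ?R \<xi> s \<partial>lebesgue) + (\<integral>\<^sup>+s\<in>{a..}. ?R \<xi> s \<partial>lebesgue)"
  proof -
    have "(\<integral>\<^sup>+s\<in>{0..}. ?R \<xi> s \<partial>lebesgue)
        = (\<integral>\<^sup>+s. ?R \<xi> s * indicator {0..<a} s + ?R \<xi> s * indicator {a..} s \<partial>lebesgue)"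
      by (rule nn_integral_cong) (use \<open>0 \<le> a\<close> in \<open>auto simp: indicator_def\<close>)
    also have "\<dots> = (\<integral>\<^sup>+s\<in>{0..<a}. ?R \<xi> s \<partial>lebesgue) + (\<integral>\<^sup>+s\<in>{a..}. ?R \<xi> s \<partial>lebesgue)"
      by (intro nn_integral_add meas_sub) (use \<open>0 \<le> a\<close> in auto)
    finally show ?thesis .
  qed
  have "(\<integral>\<^sup>+s\<in>{0..}. ?R \<xi> s \<partial>lebesgue) \<noteq> top"
    using stop[of 0] by (auto simp: top_unique)
  then have "(\<integral>\<^sup>+s\<in>{0..<a}. ?R \<xi> s \<partial>lebesgue) \<noteq> top"
    unfolding split by simp
  then show ?thesis
    using stop[OF \<open>0 \<le> a\<close>] unfolding split by (simp add: ennreal_add_left_cancel_le)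
qed

text \<open>Dropping the nonnegative term \<open>f - m\<close> and undoing the discount with the
  factor \<open>exp b\<close>, which is at least \<open>exp s\<close> on the interval, turns the
  tail bound into one on the kinetic part. Its finiteness also yields integrability.\<close>

lemma minimizing_curve_speed_integral_le:
  fixes \<Omega> :: "'a::euclidean_space set"
  assumes min: "minimizing_curve \<Omega> p q f x \<xi>" and f: "continuous_on (closure \<Omega>) f"
    and m: "\<And>y. y \<in> closure \<Omega> \<Longrightarrow> m \<le> f y" and "0 < p" and "0 < q" and "0 \<le> a" and "a \<le> b"
  defines "h \<equiv> \<lambda>s. norm (vector_derivative \<xi> (at s)) powr q"
  shows "h integrable_on {a..b}"
    and "(1 / q) * p powr (- (q / p)) * integral {a..b} h \<le> exp (b - a) * (f (\<xi> a) - m)"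
proof -
  let ?L = "lebesgue_on {a..b}"
  define c where "c = (1 / q) * p powr (- (q / p))"
  define r where "r = running_cost p q (\<lambda>y. f y - m) \<xi>"
  have "0 < c" using \<open>0 < p\<close> \<open>0 < q\<close> by (simp add: c_def)
  have AC: "\<xi> \<in> AC_curves (closure \<Omega>)" using min by (simp add: minimizing_curve_def)
  have \<phi>: "0 \<le> f (\<xi> t) - m" if "0 \<le> t" for t using m[of "\<xi> t"] AC that by (simp add: AC_curves_def)
  have [measurable]: "h \<in> borel_measurable ?L"
  proof -
    have "(\<lambda>s. vector_derivative \<xi> (at s)) \<in> borel_measurable ?L"
      by (rule measurable_restrict_mono[OF AC_curves_vector_derivative_measurable[OF AC]]) (use \<open>0 \<le> a\<close> in auto)
    then show ?thesis unfolding h_def by measurable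
  qed
  have h0: "0 \<le> h s" for s by (simp add: h_def)
  have le: "c * h s \<le> exp b * r s" if "s \<in> {a..b}" for s
  proof -
    have "c * h s \<le> c * h s + (f (\<xi> s) - m)" using \<phi>[of s] that \<open>0 \<le> a\<close> by simp
    also have "\<dots> \<le> exp (b - s) * (c * h s + (f (\<xi> s) - m))"
      using \<phi>[of s] that \<open>0 \<le> a\<close> \<open>0 < c\<close> h0[of s] mult_right_mono[of 1 "exp (b - s)" "c * h s + (f (\<xi> s) - m)"] by auto
    also have "\<dots> = exp b * r s"
      by (simp add: r_def running_cost_def c_def h_def exp_diff exp_minus field_simps)
    finally show ?thesis .
  qed
  have "(\<integral>\<^sup>+s. ennreal (c * h s) \<partial>?L) = (\<integral>\<^sup>+s\<in>{a..b}. ennreal (c * h s) \<partial>lebesgue)"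
    by (subst nn_integral_restrict_space) auto
  also have "\<dots> \<le> (\<integral>\<^sup>+s. ennreal (exp b) * (ennreal (r s) * indicator {a..} s) \<partial>lebesgue)"
  proof (rule nn_integral_mono)
    fix s :: real
    show "ennreal (c * h s) * indicator {a..b} s \<le> ennreal (exp b) * (ennreal (r s) * indicator {a..} s)"
    proof (cases "s \<in> {a..b}")
      case True
      then have "ennreal (c * h s) \<le> ennreal (exp b * r s)" using le by (intro ennreal_leI) auto
      then show ?thesis using True by (simp add: ennreal_mult')
    qed simp
  qed
  also have "\<dots> = ennreal (exp b) * (\<integral>\<^sup>+s\<in>{a..}. ennreal (r s) \<partial>lebesgue)"
  proof (rule nn_integral_cmult)
    have "(\<lambda>s. ennreal (r s)) \<in> borel_measurable (lebesgue_on {a..})"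
      unfolding r_def
      by (intro measurable_compose[OF _ measurable_ennreal] measurable_restrict_mono[OF running_cost_measurable[OF AC]] continuous_intros f)
        (use \<open>0 \<le> a\<close> in auto)
    then show "(\<lambda>s. ennreal (r s) * indicator {a..} s) \<in> borel_measurable lebesgue"
      by (subst (asm) borel_measurable_restrict_space_iff_ennreal) auto
  qed
  also have "\<dots> \<le> ennreal (exp b) * ennreal (exp (- a) * (f (\<xi> a) - m))"
    unfolding r_def using minimizing_curve_tail_le[OF min f m \<open>0 < q\<close> \<open>0 \<le> a\<close>] by (intro mult_left_mono) auto
  also have "\<dots> = ennreal (exp (b - a) * (f (\<xi> a) - m))"
    using \<phi>[OF \<open>0 \<le> a\<close>] by (simp add: exp_diff exp_minus field_simps flip: ennreal_mult)
  finally have bound: "(\<integral>\<^sup>+s. ennreal (c * h s) \<partial>?L) \<le> ennreal (exp (b - a) * (f (\<xi> a) - m))" .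
  have int: "integrable ?L (\<lambda>s. c * h s)"
  proof (rule integrableI_nonneg)
    show "(\<integral>\<^sup>+s. ennreal (c * h s) \<partial>?L) < \<infinity>" using bound by (auto intro: le_less_trans)
    show "AE s in ?L. 0 \<le> c * h s" using \<open>0 < c\<close> h0 by simp
  qed simp
  then have inth: "integrable ?L h" using \<open>0 < c\<close> by simp
  then show "h integrable_on {a..b}" by (rule integrable_on_lebesgue_on) simp
  have "ennreal (integral\<^sup>L ?L (\<lambda>s. c * h s)) \<le> ennreal (exp (b - a) * (f (\<xi> a) - m))"
    using bound \<open>0 < c\<close> h0 by (subst nn_integral_eq_integral[OF int, symmetric]) auto
  then have "integral\<^sup>L ?L (\<lambda>s. c * h s) \<le> exp (b - a) * (f (\<xi> a) - m)"
    using \<phi>[OF \<open>0 \<le> a\<close>] by (subst (asm) ennreal_le_iff) auto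
  then show "(1 / q) * p powr (- (q / p)) * integral {a..b} h \<le> exp (b - a) * (f (\<xi> a) - m)"
    using lebesgue_integral_eq_integral[OF inth] by (simp add: c_def)
qed

subsection \<open>Minimizing curves do not reach the boundary\<close>

text \<open>The gradient bound holds only on the curve, so segments between its points are out of
  reach. Instead, near each time \<open>t\<close> differentiability compares \<open>f\<close> with
  its value at \<open>\<xi> t\<close>, with constant \<open>L + \<epsilon>\<close>; bisection adds
  these estimates because increments of \<open>W\<close> are additive.\<close>

lemma along_curve_increment_le:
  fixes \<xi> :: "real \<Rightarrow> 'a::euclidean_space"
  assumes "a \<le> b" and cont: "continuous_on {a..b} \<xi>"
    and deriv: "\<And>t. t \<in> {a..b} \<Longrightarrow> GDERIV f (\<xi> t) :> Df (\<xi> t)"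
    and bound: "\<And>t. t \<in> {a..b} \<Longrightarrow> norm (Df (\<xi> t)) \<le> L"
    and W: "\<And>s t. a \<le> s \<Longrightarrow> s \<le> t \<Longrightarrow> t \<le> b \<Longrightarrow> dist (\<xi> s) (\<xi> t) \<le> W t - W s"
  shows "\<bar>f (\<xi> b) - f (\<xi> a)\<bar> \<le> L * (W b - W a)"
proof -
  have main: "\<bar>f (\<xi> b) - f (\<xi> a)\<bar> \<le> (L + \<epsilon>) * (W b - W a)" if "0 < \<epsilon>" for \<epsilon> :: real
  proof -
    \<comment> \<open>The guards are there because the short intervals in the bisection principle
      may leave \<open>{a..b}\<close>.\<close>
    define Q where "Q c d \<longleftrightarrow> (a \<le> c \<longrightarrow> d \<le> b \<longrightarrow> \<bar>f (\<xi> d) - f (\<xi> c)\<bar> \<le> (L + \<epsilon>) * (W d - W c))" for c d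
    have "Q a b"
      using \<open>a \<le> b\<close>
    proof (induction rule: Bolzano)
      case (trans c d e)
      show ?case
        unfolding Q_def
      proof (intro impI)
        assume "a \<le> c" "e \<le> b"
        then have "\<bar>f (\<xi> d) - f (\<xi> c)\<bar> \<le> (L + \<epsilon>) * (W d - W c)" "\<bar>f (\<xi> e) - f (\<xi> d)\<bar> \<le> (L + \<epsilon>) * (W e - W d)"
          using trans by (auto simp: Q_def)
        moreover have "(L + \<epsilon>) * (W d - W c) + (L + \<epsilon>) * (W e - W d) = (L + \<epsilon>) * (W e - W c)"
          by (simp add: algebra_simps)
        ultimately show "\<bar>f (\<xi> e) - f (\<xi> c)\<bar> \<le> (L + \<epsilon>) * (W e - W c)" by linarith
      qed
    next
      case (local t)
      then have t: "t \<in> {a..b}" by simp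
      have "(f has_derivative (\<lambda>h. h \<bullet> Df (\<xi> t))) (at (\<xi> t))"
        using deriv[OF t] by (simp add: gderiv_def)
      then obtain r where r: "0 < r"
        "\<And>y. norm (y - \<xi> t) < r \<Longrightarrow> norm (f y - f (\<xi> t) - (y - \<xi> t) \<bullet> Df (\<xi> t)) \<le> \<epsilon> * norm (y - \<xi> t)"
        unfolding has_derivative_at_alt using \<open>0 < \<epsilon>\<close> by blast
      have near: "\<bar>f y - f (\<xi> t)\<bar> \<le> (L + \<epsilon>) * dist y (\<xi> t)" if "dist y (\<xi> t) < r" for y
      proof -
        have "\<bar>(y - \<xi> t) \<bullet> Df (\<xi> t)\<bar> \<le> norm (y - \<xi> t) * norm (Df (\<xi> t))" by (rule Cauchy_Schwarz_ineq2)
        also have "\<dots> \<le> norm (y - \<xi> t) * L" by (rule mult_left_mono[OF bound[OF t]]) simp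
        finally show ?thesis using r(2)[of y] that by (simp add: dist_norm algebra_simps)
      qed
      obtain d where d: "0 < d" "\<And>s. s \<in> {a..b} \<Longrightarrow> dist s t < d \<Longrightarrow> dist (\<xi> s) (\<xi> t) < r"
        using cont t r(1) unfolding continuous_on_iff by blast
      have "0 \<le> L" using bound[OF t] by (rule order_trans[OF norm_ge_zero])
      then have L: "0 \<le> L + \<epsilon>" using \<open>0 < \<epsilon>\<close> by simp
      \<comment> \<open>The local estimate is anchored at \<open>t\<close>, so the interval is split
        there.\<close>
      have "Q u v" if "u \<le> t \<and> t \<le> v \<and> v - u < d" for u v
        unfolding Q_def
      proof (intro impI)
        assume uv: "a \<le> u" "v \<le> b"
        have "\<bar>f (\<xi> u) - f (\<xi> t)\<bar> \<le> (L + \<epsilon>) * dist (\<xi> u) (\<xi> t)"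
          by (intro near d) (use uv that in \<open>auto simp: dist_real_def\<close>)
        also have "\<dots> \<le> (L + \<epsilon>) * (W t - W u)" by (intro mult_left_mono W L) (use uv that in auto)
        finally have 1: "\<bar>f (\<xi> u) - f (\<xi> t)\<bar> \<le> (L + \<epsilon>) * (W t - W u)" .
        have "\<bar>f (\<xi> v) - f (\<xi> t)\<bar> \<le> (L + \<epsilon>) * dist (\<xi> v) (\<xi> t)"
          by (intro near d) (use uv that in \<open>auto simp: dist_real_def\<close>)
        also have "\<dots> \<le> (L + \<epsilon>) * (W v - W t)"
          unfolding dist_commute[of "\<xi> v"] by (intro mult_left_mono W L) (use uv that in auto)
        finally have 2: "\<bar>f (\<xi> v) - f (\<xi> t)\<bar> \<le> (L + \<epsilon>) * (W v - W t)" .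
        have "(L + \<epsilon>) * (W t - W u) + (L + \<epsilon>) * (W v - W t) = (L + \<epsilon>) * (W v - W u)"
          by (simp add: algebra_simps)
        with 1 2 show "\<bar>f (\<xi> v) - f (\<xi> u)\<bar> \<le> (L + \<epsilon>) * (W v - W u)" by linarith
      qed
      then show ?case using d(1) by blast
    qed
    then show ?thesis by (simp add: Q_def)
  qed
  have Wab: "0 \<le> W b - W a" using order_trans[OF zero_le_dist W[of a b]] \<open>a \<le> b\<close> by auto
  show ?thesis
  proof (rule field_le_epsilon)
    fix e :: real assume "0 < e"
    define \<epsilon> where "\<epsilon> = e / (W b - W a + 1)"
    have "0 < \<epsilon>" using \<open>0 < e\<close> Wab by (simp add: \<epsilon>_def)
    have "\<epsilon> * (W b - W a) \<le> e" using \<open>0 < e\<close> Wab by (simp add: \<epsilon>_def field_simps)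
    then show "\<bar>f (\<xi> b) - f (\<xi> a)\<bar> \<le> L * (W b - W a) + e"
      using main[OF \<open>0 < \<epsilon>\<close>] by (simp add: distrib_right)
  qed
qed

text \<open>Above the threshold \<open>\<Lambda>\<close> the factor \<open>v powr (1 - q)\<close> is
  at most \<open>\<Lambda> powr (1 - q)\<close>, as the exponent is negative. The free threshold is
  what later balances the two terms.\<close>

lemma speed_le_Young:
  fixes v \<Lambda> q :: real
  assumes "0 \<le> v" "0 < \<Lambda>" "1 < q"
  shows "v \<le> \<Lambda> + \<Lambda> powr (1 - q) * v powr q"
proof (cases "v \<le> \<Lambda>")
  case True
  then show ?thesis by (simp add: add_increasing2)
next
  case False
  then have "v = v powr (1 - q) * v powr q" using assms by (simp flip: powr_add)
  also have "\<dots> \<le> \<Lambda> powr (1 - q) * v powr q"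
    using False assms by (intro mult_right_mono powr_mono2') auto
  finally show ?thesis using assms by simp
qed

theorem proposition1p2:
  fixes \<Omega> :: "(real ^ 'n) set"
    and f u :: "real ^ 'n \<Rightarrow> real"
    and Df :: "real ^ 'n \<Rightarrow> real ^ 'n"
    and p q :: real
    and x :: "real ^ 'n"
    and \<xi> :: "real \<Rightarrow> real ^ 'n"
  assumes "open \<Omega>" and "bounded \<Omega>" and "connected \<Omega>" and "C2_boundary \<Omega>"
    and "1 < p" and "p \<le> 2" and "1 / p + 1 / q = 1"
    and "C1_on_closure \<Omega> f Df" and "semiconcave_on \<Omega> f"
    and "\<forall>z\<in>frontier \<Omega>. f z = (INF y\<in>closure \<Omega>. f y)"
    and "\<forall>z\<in>\<Omega>. f z > (INF y\<in>closure \<Omega>. f y)"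
    and "\<exists>C>0. \<forall>z\<in>\<Omega>. norm (Df z) \<le> C * (f z - (INF y\<in>closure \<Omega>. f y)) powr (1 / p)"
    and "constrained_viscosity_solution \<Omega> (hamiltonian p f) u"
    and "x \<in> \<Omega>"
    and "minimizing_curve \<Omega> p q f x \<xi>"
  shows "hitting_time \<Omega> \<xi> = \<infinity>"
proof (rule ccontr)
  define m where "m = (INF y\<in>closure \<Omega>. f y)"
  define \<phi> where "\<phi> t = f (\<xi> t) - m" for t
  have f: "continuous_on (closure \<Omega>) f" and Df: "\<And>z. z \<in> \<Omega> \<Longrightarrow> GDERIV f z :> Df z"
    using assms(8) by (auto simp: C1_on_closure_def C1_on_def)
  have "compact (closure \<Omega>)" using assms(2) by (simp add: compact_closure)
  then have "bdd_below (f ` closure \<Omega>)"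
    using compact_continuous_image[OF f] by (simp add: bounded_imp_bdd_below compact_imp_bounded)
  then have m: "m \<le> f y" if "y \<in> closure \<Omega>" for y unfolding m_def using that by (rule cINF_lower)
  obtain C where "0 < C" and C: "\<And>z. z \<in> \<Omega> \<Longrightarrow> norm (Df z) \<le> C * (f z - m) powr (1 / p)"
    using assms(12) by (auto simp: m_def)
  have "1 < q"
  proof -
    have "1 / q = 1 - 1 / p" using assms(7) by simp
    then have "0 < 1 / q" "1 / q < 1" using assms(5) by auto
    then show ?thesis by (simp add: divide_less_eq split: if_splits)
  qed
  have pq: "1 / p + 1 / q = 1" by fact
  have AC: "\<xi> \<in> AC_curves (closure \<Omega>)" and x0: "\<xi> 0 \<in> \<Omega>"
    using assms(14,15) by (auto simp: minimizing_curve_def)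
  have cont: "continuous_on {0..} \<xi>" by (rule AC_curves_continuous_on[OF AC])
  have cl: "\<xi> t \<in> closure \<Omega>" if "0 \<le> t" for t using AC that by (simp add: AC_curves_def)
  have cont\<phi>: "continuous_on {0..} \<phi>"
    unfolding \<phi>_def by (intro continuous_intros continuous_on_compose2[OF f cont]) (auto intro: cl)

  define S where "S = {t \<in> {0..}. \<xi> t \<in> frontier \<Omega>}"
  assume "hitting_time \<Omega> \<xi> \<noteq> \<infinity>"
  then have "S \<noteq> {}" by (auto simp: hitting_time_def S_def top_ereal_def[symmetric] intro: ccontr)
  \<comment> \<open>Closedness makes the infimum \<open>T\<close> a time at which the boundary is
    actually met.\<close>
  have "closed S"
    using continuous_closed_preimage[OF cont closed_atLeast frontier_closed[of \<Omega>]]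
    by (simp add: S_def vimage_def Int_def)
  define T where "T = Inf S"
  have bdd: "bdd_below S" by (rule bdd_belowI[of _ 0]) (simp add: S_def)
  have "T \<in> S" unfolding T_def by (rule closed_contains_Inf[OF \<open>S \<noteq> {}\<close> bdd \<open>closed S\<close>])
  then have T: "0 \<le> T" "\<xi> T \<in> frontier \<Omega>" by (auto simp: S_def)
  have inside: "\<xi> t \<in> \<Omega>" if "0 \<le> t" "t < T" for t
  proof -
    have "t \<notin> S" using that bdd cInf_lower[of t S] by (force simp: T_def)
    then have "\<xi> t \<notin> frontier \<Omega>" using that by (simp add: S_def)
    then show ?thesis using cl[OF that(1)] assms(1) by (simp add: frontier_def interior_open)
  qed
  have "0 < T"
    using T x0 assms(1) by (cases "T = 0") (auto simp: frontier_def interior_open)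
  have \<phi>T: "\<phi> T = 0" using assms(10) T by (simp add: \<phi>_def m_def)
  have \<phi>pos: "0 < \<phi> t" if "0 \<le> t" "t < T" for t
    using assms(11) inside[OF that] by (simp add: \<phi>_def m_def)

  define c where "c = (1 / q) * p powr (- (q / p))"
  have "0 < c" using assms(5) \<open>1 < q\<close> by (simp add: c_def)
  \<comment> \<open>Chosen so that the kinetic Young term contributes exactly \<open>M / 4\<close>
    to the drop; \<open>exp 1\<close> stands for the bound on \<open>exp (T - a)\<close>.\<close>
  define \<Lambda> where "\<Lambda> = (c / (4 * exp 1 * C)) powr (1 / (1 - q))"
  have "0 < \<Lambda>" using \<open>0 < c\<close> \<open>0 < C\<close> by (simp add: \<Lambda>_def)
  have \<Lambda>: "\<Lambda> powr (1 - q) = c / (4 * exp 1 * C)"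
    using \<open>1 < q\<close> \<open>0 < c\<close> \<open>0 < C\<close> by (simp add: \<Lambda>_def powr_powr)
  \<comment> \<open>The second entry bounds the contribution of the constant Young term by
    \<open>M / 4\<close>; the first gives \<open>exp (T - a) \<le> exp 1\<close>. Neither depends on
    \<open>M\<close>.\<close>
  define \<delta> where "\<delta> = min 1 (1 / (4 * C * \<Lambda>))"
  have "0 < \<delta>" "\<delta> \<le> 1" and \<delta>: "C * \<Lambda> * \<delta> \<le> 1 / 4"
    using \<open>0 < C\<close> \<open>0 < \<Lambda>\<close> by (auto simp: \<delta>_def min_def field_simps)
  define T' where "T' = max 0 (T - \<delta>)"
  have T': "0 \<le> T'" "T' < T" "T - T' \<le> \<delta>" using \<open>0 < T\<close> \<open>0 < \<delta>\<close> by (auto simp: T'_def)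
  obtain a where a: "a \<in> {T'..T}" and max: "\<And>t. t \<in> {T'..T} \<Longrightarrow> \<phi> t \<le> \<phi> a"
    using continuous_attains_sup[of "{T'..T}" \<phi>] T' continuous_on_subset[OF cont\<phi>, of "{T'..T}"] by auto
  define M where "M = \<phi> a"
  have "0 < M" using \<phi>pos[of T'] max[of T'] T' by (simp add: M_def)
  then have "a < T" using a \<phi>T by (cases "a = T") (auto simp: M_def)
  have "0 \<le> a" using a T' by simp

  \<comment> \<open>The threshold scales like \<open>M powr (1 / q)\<close>, the size of the length
    bound sought.\<close>
  define \<mu> where "\<mu> = \<Lambda> * M powr (1 / q)"
  have "0 < \<mu>" using \<open>0 < \<Lambda>\<close> \<open>0 < M\<close> by (simp add: \<mu>_def)
  define h where "h s = norm (vector_derivative \<xi> (at s)) powr q" for s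
  \<comment> \<open>Young's bound on the speed, integrable because \<open>h\<close> is; its
    primitive \<open>W\<close> serves as the length majorant.\<close>
  define g where "g s = \<mu> + \<mu> powr (1 - q) * h s" for s
  have hint: "h integrable_on {a..T}" and hle: "c * integral {a..T} h \<le> exp (T - a) * M"
    using minimizing_curve_speed_integral_le[OF assms(15) f m _ _ \<open>0 \<le> a\<close>, of T] assms(5) \<open>1 < q\<close> \<open>a < T\<close>
    by (auto simp: h_def[abs_def] c_def M_def \<phi>_def)
  have hint': "(\<lambda>s. \<mu> powr (1 - q) * h s) integrable_on {a..T}"
    using integrable_cmul[OF hint, of "\<mu> powr (1 - q)"] by simp
  have gint: "g integrable_on {a..T}"
    unfolding g_def by (intro integrable_add integrable_const_ivl hint')
  define W where "W t = integral {a..t} g" for t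
  have W: "dist (\<xi> s) (\<xi> t) \<le> W t - W s" if st: "a \<le> s" "s \<le> t" "t \<le> T" for s t
  proof -
    have "abs_cont_on 0 T \<xi>" using AC T(1) by (simp add: AC_curves_def)
    then have "abs_cont_on s t \<xi>" by (rule abs_cont_on_subinterval) (use st \<open>0 \<le> a\<close> in auto)
    then have v: "((\<lambda>s. vector_derivative \<xi> (at s)) has_integral (\<xi> t - \<xi> s)) {s..t}"
      using st(2) by (rule abs_cont_on_has_integral_vector_derivative)
    have "dist (\<xi> s) (\<xi> t) = norm (integral {s..t} (\<lambda>s. vector_derivative \<xi> (at s)))"
      using integral_unique[OF v] by (simp add: dist_norm norm_minus_commute)
    also have "\<dots> \<le> integral {s..t} g"
    proof (rule integral_norm_bound_integral)
      show "g integrable_on {s..t}" by (rule integrable_subinterval_real[OF gint]) (use st in auto)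
      show "norm (vector_derivative \<xi> (at r)) \<le> g r" for r
        unfolding g_def h_def by (rule speed_le_Young) (use \<open>0 < \<mu>\<close> \<open>1 < q\<close> in auto)
    qed (use v in \<open>auto simp: has_integral_integrable\<close>)
    also have "\<dots> = W t - W s"
      unfolding W_def using st integrable_subinterval_real[OF gint, of a t]
      by (simp add: Henstock_Kurzweil_Integration.integral_combine[of a s t g, symmetric])
    finally show ?thesis .
  qed
  have WT: "C * M powr (1 / p) * (W T - W a) \<le> M / 4 + M / 4"
  proof -
    have "W T - W a = \<mu> * (T - a) + \<mu> powr (1 - q) * integral {a..T} h"
      unfolding W_def g_def using hint' \<open>a < T\<close>
      by (subst Henstock_Kurzweil_Integration.integral_add) (auto simp: mult.commute)
    also have "\<dots> \<le> \<mu> * \<delta> + \<mu> powr (1 - q) * (exp 1 * M / c)"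
    proof (intro add_mono mult_left_mono)
      show "T - a \<le> \<delta>" using a T' by simp
      then have "exp (T - a) * M \<le> exp 1 * M" using \<open>\<delta> \<le> 1\<close> \<open>0 < M\<close> by (intro mult_right_mono) auto
      then show "integral {a..T} h \<le> exp 1 * M / c" using hle \<open>0 < c\<close> by (simp add: field_simps)
    qed (use \<open>0 < \<mu>\<close> in auto)
    finally have le: "W T - W a \<le> \<mu> * \<delta> + \<mu> powr (1 - q) * (exp 1 * M / c)" .
    have e1: "C * M powr (1 / p) * (\<mu> * \<delta>) = (C * \<Lambda> * \<delta>) * M"
    proof -
      have "M powr (1 / p) * M powr (1 / q) = M"
        using pq \<open>0 < M\<close> by (simp flip: powr_add)
      then show ?thesis by (simp add: \<mu>_def algebra_simps)
    qed
    have e2: "C * M powr (1 / p) * (\<mu> powr (1 - q) * (exp 1 * M / c)) = M / 4"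
    proof -
      \<comment> \<open>Conjugacy of \<open>p\<close> and \<open>q\<close> makes the power of
        \<open>M\<close> in the Young factor cancel the one from hypothesis (3).\<close>
      have "M powr (1 / p) * M powr (1 / q * (1 - q)) = M powr 0"
      proof -
        have "1 / p + 1 / q * (1 - q) = 0" using pq \<open>1 < q\<close> by (simp add: field_simps)
        then show ?thesis by (simp flip: powr_add)
      qed
      then have "M powr (1 / p) * \<mu> powr (1 - q) = c / (4 * exp 1 * C)"
        using \<open>0 < M\<close> \<open>0 < \<Lambda>\<close> \<Lambda> by (simp add: \<mu>_def powr_mult powr_powr mult.left_commute)
      then have "C * (M powr (1 / p) * \<mu> powr (1 - q)) * (exp 1 * M / c) = M / 4"
        using \<open>0 < c\<close> \<open>0 < C\<close> by simp
      then show ?thesis by (simp add: mult.assoc)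
    qed
    have "C * M powr (1 / p) * (W T - W a)
        \<le> C * M powr (1 / p) * (\<mu> * \<delta> + \<mu> powr (1 - q) * (exp 1 * M / c))"
      by (rule mult_left_mono[OF le]) (use \<open>0 < C\<close> in simp)
    also have "\<dots> = (C * \<Lambda> * \<delta>) * M + M / 4" by (simp only: distrib_left e1 e2)
    also have "\<dots> \<le> M / 4 + M / 4"
      using mult_right_mono[OF \<delta> less_imp_le[OF \<open>0 < M\<close>]] by linarith
    finally show ?thesis .
  qed
  \<comment> \<open>Restricted to \<open>t < T\<close>, since at \<open>T\<close> the curve is on
    the boundary, where differentiability of \<open>f\<close> in a full neighbourhood is not given.
    Continuity of \<open>\<phi>\<close> then carries the bound to \<open>T\<close>.\<close>
  have half: "M / 2 \<le> \<phi> t" if t: "a \<le> t" "t < T" for t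
  proof -
    have "\<bar>f (\<xi> t) - f (\<xi> a)\<bar> \<le> (C * M powr (1 / p)) * (W t - W a)"
    proof (rule along_curve_increment_le[where Df = Df, OF t(1)])
      show "continuous_on {a..t} \<xi>" by (rule continuous_on_subset[OF cont]) (use \<open>0 \<le> a\<close> in auto)
      fix s assume s: "s \<in> {a..t}"
      then have "\<xi> s \<in> \<Omega>" using inside[of s] \<open>0 \<le> a\<close> t by auto
      then show "GDERIV f (\<xi> s) :> Df (\<xi> s)" by (rule Df)
      have "norm (Df (\<xi> s)) \<le> C * \<phi> s powr (1 / p)" using C[OF \<open>\<xi> s \<in> \<Omega>\<close>] by (simp add: \<phi>_def)
      \<comment> \<open>Maximality of \<open>\<phi>\<close> at \<open>a\<close> makes the gradient
        bound uniform in \<open>s\<close>.\<close>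
      also have "\<dots> \<le> C * M powr (1 / p)"
        using \<phi>pos[of s] max[of s] s t a T' \<open>0 < C\<close> assms(5)
        by (intro mult_left_mono powr_mono2) (auto simp: M_def)
      finally show "norm (Df (\<xi> s)) \<le> C * M powr (1 / p)" .
    qed (use W t in auto)
    also have "\<dots> \<le> (C * M powr (1 / p)) * (W T - W a)"
      using order_trans[OF zero_le_dist W[of t T]] t \<open>0 < C\<close> by (intro mult_left_mono) auto
    finally show ?thesis using WT by (simp add: M_def \<phi>_def abs_le_iff)
  qed
  have "M / 2 \<le> \<phi> T"
  proof (rule tendsto_lowerbound)
    have "continuous_on {a..T} \<phi>" by (rule continuous_on_subset[OF cont\<phi>]) (use \<open>0 \<le> a\<close> in auto)
    then show "(\<phi> \<longlongrightarrow> \<phi> T) (at_left T)" using \<open>a < T\<close> by (rule continuous_on_Icc_at_leftD)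
    show "\<forall>\<^sub>F t in at_left T. M / 2 \<le> \<phi> t"
      by (rule eventually_at_leftI[OF _ \<open>a < T\<close>]) (use half in auto)
  qed simp
  then show False using \<phi>T \<open>0 < M\<close> by simp
qed

end
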